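(* If $M_n(s)$ denotes the number of $n\times n$ magic squares of magic sum $s$, then, from the minimal Hilbert bases for the cones of $4\times 4$ and $5\times 5$ magic squares, one obtains $$\sum_{s=0}^{\infty} M_4(s)t^s = \frac{t^8 + 4t^7 + 18t^6 + 36t^5 + 50t^4 + 36t^3 + 18t^2 + 4t + 1}{(1-t)^4(1-t^2)^4}$$ $$= 1 + 8t + 48t^2 + 200t^3 + 675t^4 + 1904t^5 + 4736t^6 + 10608t^7 + 21925t^8 + \cdots,$$ and specifically $$M_4(s) = \begin{cases} \frac{1}{480}s^7 + \frac{7}{240}s^6 + \frac{89}{480}s^5 + \frac{11}{16}s^4 + \frac{49}{30}s^3 + \frac{38}{15}s^2 + \frac{71}{30}s + 1 & \text{if } 2\mid s, \\[4pt] \frac{1}{480}s^7 + \frac{7}{240}s^6 + \frac{89}{480}s^5 + \frac{11}{16}s^4 + \frac{779}{480}s^3 + \frac{593}{240}s^2 + \frac{1051}{480}s + \frac{13}{16} & \text{otherwise.} \end{cases}$$ The values of $M_5(s)$ for $s\le 6$ are also known. The polytope of stochastic $n\times n$ magic squares is not integral for $n>2$.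
   Context: An $n\times n$ magic square is an $n\times n$ matrix with nonnegative integer entries (repetitions allowed) whose row sums, column sums, and two main diagonal sums are all equal to the same integer $s$, called the magic sum. The cone of $n\times n$ magic squares is the set of all real nonnegative $n\times n$ matrices whose row sums, column sums and two main diagonal sums are all equal to each other; it is a pointed rational polyhedral cone in $\mathbb{R}^{n^2}$, and its integer points are exactly the $n\times n$ magic squares. A Hilbert basis of such a cone $C$ is a finite set of integer points of $C$ such that every integer point of $C$ is a nonnegative integer linear combination of elements of the set; the minimal Hilbert basis is the (unique) inclusion-minimal one. The polytope of stochastic $n\times n$ magic squares is the set of all real nonnegative $n\times n$ matrices all of whose row sums, column sums and two main diagonal sums equal $1$. A polytope is integral if all its vertices have integer coordinates. *)

theory Defs
  imports "HOL-Analysis.Analysis" "HOL-Computational_Algebra.Formal_Power_Series"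
begin

type_synonym ('a, 'n) square_matrix = "(('a, 'n) vec, 'n) vec"

text \<open>
  An n by n matrix is indexed by a finite linearly ordered type with n elements.  The order
  is used to locate the secondary diagonal: it consists of the positions (i, j) such that as
  many indices lie below i as lie above j, i.e. i + j = n + 1 for indices 1, ..., n.
\<close>

definition all_line_sums :: "('a::comm_monoid_add, 'n::{finite,linorder}) square_matrix \<Rightarrow> 'a \<Rightarrow> bool" where
  "all_line_sums A s \<longleftrightarrow>
     (\<forall>i. (\<Sum>j\<in>UNIV. A $ i $ j) = s) \<and>
     (\<forall>j. (\<Sum>i\<in>UNIV. A $ i $ j) = s) \<and>
     (\<Sum>i\<in>UNIV. A $ i $ i) = s \<and>
     (\<Sum>(i, j) | card {..<i} = card {j<..}. A $ i $ j) = s"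

definition magic_squares :: "nat \<Rightarrow> (nat, 'n::{finite,linorder}) square_matrix set" where
  "magic_squares s = {A. all_line_sums A s}"

text \<open>The type argument carries the size n = CARD('n) of the squares.\<close>

definition num_magic_squares :: "'n::{finite,linorder} itself \<Rightarrow> nat \<Rightarrow> nat" where
  "num_magic_squares _ s = card (magic_squares s :: (nat, 'n) square_matrix set)"

definition stochastic_magic_squares :: "(real, 'n::{finite,linorder}) square_matrix set" where
  "stochastic_magic_squares = {A. (\<forall>i j. 0 \<le> A $ i $ j) \<and> all_line_sums A 1}"

definition integral_polytope :: "(real, 'n::finite) square_matrix set \<Rightarrow> bool" where
  "integral_polytope P \<longleftrightarrow> (\<forall>v. v extreme_point_of P \<longrightarrow> (\<forall>i j. v $ i $ j \<in> \<int>))"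

end

theory Submission
  imports Defs
begin

text \<open>
  Pair index \<open>i\<close> with its mirror image. The entries at positions \<open>(i, j)\<close> with \<open>j\<close> equal or opposite to
  \<open>i\<close> form nested 2 by 2 shells; once these (and, for odd size, the middle row and column) are chosen,
  the remaining entries split into 2 by 2 blocks with prescribed row and column sums, each of which can
  be filled in \<open>1 + min\<close> ways. Writing \<open>1 + min\<close> as a number of thresholds makes the inner and the outer
  shell independent. For size 4 this gives
  \<open>M(s) = (\<Sum>p\<le>s. \<Sum>k l. N(p, s - p, k, l)\<^sup>2)\<close>, where \<open>N(p, q, k, l)\<close> counts the lattice points of a
  \<open>p \<times> q\<close> box with its corners cut off at depths \<open>k\<close> and \<open>l\<close>; \<open>N\<close> is piecewise quadratic and the sum can
  be evaluated symbolically. For size 5 the analogous sum is small enough to be evaluated numerically.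

  If the polytope were integral, each of its nonempty faces would contain an integral point; for each
  size \<open>n > 2\<close> there is a face without one.
\<close>

section \<open>Indexing by natural numbers\<close>

text \<open>The obstacle is that each 2 by 2 block takes its row sums from one shell and its column
  sums from the other. Hence the thresholds \<open>k\<close> and \<open>l\<close> exchange roles
  between the shells: what bounds the rows of the outer shell bounds the columns of the inner one.
  In size 4 the corners of a magic square sum to \<open>s\<close>, which leaves a single parameter
  \<open>p\<close> for the four diagonal sums, and the region of the inner shell is that of the
  outer one after a quarter turn; this is where the square comes from. Two parities cause the case
  distinctions. Two cut lines of the box meet either in a lattice point or halfway between two,
  according to the parity of \<open>k + l + p\<close>, and the largest possible threshold is half of
  \<open>s\<close>, rounded down. In the final count the two parities of \<open>s\<close> differ
  only by a cubic polynomial.\<close>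

definition rank_of :: "'n::{finite,linorder} \<Rightarrow> nat" where
  "rank_of i = card {..<i}"

definition idx :: "nat \<Rightarrow> 'n::{finite,linorder}" where
  "idx = inv_into UNIV rank_of"

lemma rank_less_iff: "rank_of i < rank_of j \<longleftrightarrow> i < (j::'n::{finite,linorder})"
proof -
  have "rank_of i < rank_of j" if "i < j" for i j :: 'n
    unfolding rank_of_def by (rule psubset_card_mono) (use that in auto)
  thus ?thesis by (metis linorder_neq_iff order_less_asym order_less_irrefl)
qed

lemma rank_of_bij: "bij_betw (rank_of :: 'n::{finite,linorder} \<Rightarrow> nat) UNIV {..<CARD('n)}"
proof -
  have inj: "inj (rank_of :: 'n \<Rightarrow> nat)"
    by (rule injI) (metis linorder_neq_iff order_less_irrefl rank_less_iff)
  have "rank_of i < CARD('n)" for i :: 'n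
    unfolding rank_of_def by (rule psubset_card_mono) auto
  hence "range (rank_of :: 'n \<Rightarrow> nat) = {..<CARD('n)}"
    by (intro card_subset_eq) (auto simp: card_image inj)
  thus ?thesis using inj by (simp add: bij_betw_def)
qed

lemma idx_bij: "bij_betw (idx :: nat \<Rightarrow> 'n::{finite,linorder}) {..<CARD('n)} UNIV"
  unfolding idx_def by (rule bij_betw_inv_into[OF rank_of_bij])

lemma idx_rank [simp]: "idx (rank_of i) = i"
  unfolding idx_def using rank_of_bij by (metis bij_betw_inv_into_left iso_tuple_UNIV_I)

lemma rank_idx [simp]: "k < CARD('n) \<Longrightarrow> rank_of (idx k :: 'n::{finite,linorder}) = k"
  unfolding idx_def using rank_of_bij by (metis bij_betw_inv_into_right lessThan_iff)

lemma rank_lt_card [simp]: "rank_of (i::'n::{finite,linorder}) < CARD('n)"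
  using rank_of_bij by (metis bij_betwE iso_tuple_UNIV_I lessThan_iff)

lemma sum_idx: "(\<Sum>i\<in>UNIV. f (i::'n::{finite,linorder})) = (\<Sum>k<CARD('n). f (idx k))"
  by (rule sum.reindex_bij_betw[symmetric, OF idx_bij])

lemma all_idx: "(\<forall>i::'n::{finite,linorder}. Q i) \<longleftrightarrow> (\<forall>k<CARD('n). Q (idx k))"
  by (metis idx_rank rank_lt_card)

lemma card_above: "card {j<..} = CARD('n) - 1 - rank_of (j::'n::{finite,linorder})"
proof -
  have "CARD('n) = card ({..<j} \<union> ({j} \<union> {j<..}))"
    by (rule arg_cong[where f = card]) auto
  also have "\<dots> = card {..<j} + (1 + card {j<..})"
    by (subst card_Un_disjoint; auto)+
  finally show ?thesis by (simp add: rank_of_def)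
qed

definition line_sums :: "nat \<Rightarrow> (nat \<Rightarrow> nat \<Rightarrow> 'a::comm_monoid_add) \<Rightarrow> 'a \<Rightarrow> bool" where
  "line_sums n B s \<longleftrightarrow>
    (\<forall>k<n. (\<Sum>l<n. B k l) = s) \<and> (\<forall>l<n. (\<Sum>k<n. B k l) = s) \<and>
    (\<Sum>k<n. B k k) = s \<and> (\<Sum>k<n. B k (n - 1 - k)) = s"

text \<open>Only the secondary diagonal needs an argument: \<open>n - 1 - rank_of j\<close> indices
  lie above \<open>j\<close>, so each row meets that diagonal in exactly one column and the sum over
  pairs becomes a sum over rows.\<close>

lemma all_line_sums_idx:
  fixes A :: "('a::comm_monoid_add, 'n::{finite,linorder}) square_matrix"
  shows "all_line_sums A s \<longleftrightarrow> line_sums CARD('n) (\<lambda>k l. A $ idx k $ idx l) s"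
proof -
  define B where "B = (\<lambda>k l. A $ idx k $ idx l)"
  define n where "n = CARD('n)"
  have rev: "CARD('n) - Suc (CARD('n) - Suc (rank_of i)) = rank_of i" for i :: 'n
    using rank_lt_card[of i] by linarith
  have "(\<Sum>(i, j) | card {..<i} = card {j<..}. A $ i $ j) = (\<Sum>i\<in>UNIV. A $ i $ idx (n - 1 - rank_of i))"
    by (rule sum.reindex_bij_witness[where i = "\<lambda>i. (i, idx (n - 1 - rank_of i))" and j = fst])
       (auto simp: card_above n_def rev simp flip: rank_of_def)
  also have "\<dots> = (\<Sum>k<n. B k (n - 1 - k))"
    unfolding sum_idx B_def n_def by (rule sum.cong) auto
  finally show ?thesis
    unfolding all_line_sums_def line_sums_def all_idx sum_idx B_def n_def by simp
qed

lemma all_line_sums_of_nat_matrix: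
  "all_line_sums ((\<chi> i j. B (rank_of i) (rank_of j)) :: ('a::comm_monoid_add, 'n::{finite,linorder}) square_matrix) s
    \<longleftrightarrow> line_sums CARD('n) B s"
  unfolding all_line_sums_idx line_sums_def
  by (intro conj_cong arg_cong2[where f = "(=)"] refl sum.cong all_cong) auto

section \<open>Non-integrality of the polytope\<close>

text \<open>Together with closedness and convexity below, this makes the polytope the convex hull of
  its extreme points. The norm is at most the sum of all entries, to which each row contributes
  1.\<close>

lemma bounded_stochastic:
  "bounded (stochastic_magic_squares :: (real, 'n::{finite,linorder}) square_matrix set)"
proof (rule boundedI)
  fix A :: "(real, 'n) square_matrix"
  assume A: "A \<in> stochastic_magic_squares"
  have "norm A \<le> (\<Sum>i\<in>UNIV. norm (A $ i))"
    unfolding norm_vec_def by (rule L2_set_le_sum) auto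
  also have "\<dots> \<le> (\<Sum>i\<in>UNIV. \<Sum>j\<in>UNIV. \<bar>A $ i $ j\<bar>)"
    by (intro sum_mono norm_le_l1_cart)
  also have "\<dots> = (\<Sum>i\<in>(UNIV::'n set). 1)"
    using A by (intro sum.cong) (auto simp: stochastic_magic_squares_def all_line_sums_def)
  finally show "norm A \<le> real CARD('n)" by simp
qed

lemma closed_stochastic:
  "closed (stochastic_magic_squares :: (real, 'n::{finite,linorder}) square_matrix set)"
  unfolding stochastic_magic_squares_def all_line_sums_def case_prod_unfold
  by (intro closed_Collect_conj closed_Collect_all closed_Collect_eq closed_Collect_le
      continuous_intros)

lemma convex_stochastic:
  "convex (stochastic_magic_squares :: (real, 'n::{finite,linorder}) square_matrix set)"
  by (rule convexI)
     (auto simp: stochastic_magic_squares_def all_line_sums_def case_prod_unfold sum.distrib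
           simp flip: sum_distrib_left)

text \<open>The points of an integral polytope of nonnegative matrices that vanish at given positions
  form a face; if nonempty, this face contains an integral point.\<close>

lemma not_integral_if_face_not_integral:
  fixes A :: "(real, 'n::{finite,linorder}) square_matrix"
  assumes A: "A \<in> stochastic_magic_squares"
    and face: "\<And>B :: (real, 'n) square_matrix. B \<in> stochastic_magic_squares \<Longrightarrow>
      (\<And>i j. A $ i $ j = 0 \<Longrightarrow> B $ i $ j = 0) \<Longrightarrow> \<exists>i j. B $ i $ j \<notin> \<int>"
  shows "\<not> integral_polytope (stochastic_magic_squares :: (real, 'n) square_matrix set)"
proof
  let ?P = "stochastic_magic_squares :: (real, 'n) square_matrix set"
  let ?Z = "{x. A $ fst x $ snd x = 0}"
  define f where "f = (\<lambda>B :: (real, 'n) square_matrix. \<Sum>x\<in>?Z. B $ fst x $ snd x)"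
  assume int: "integral_polytope ?P"
  \<comment> \<open>\<open>f\<close> is a nonnegative integer at an extreme point, and the value 0
    would put that point on the face of \<open>A\<close>. So all extreme points, hence the whole
    polytope, lie in the half-space \<open>f B \<ge> 1\<close>, whereas
    \<open>f A = 0\<close>.\<close>
  have "f B \<ge> 1" if B: "B extreme_point_of ?P" for B
  proof (rule ccontr)
    have BP: "B \<in> ?P" using B by (simp add: extreme_point_of_def)
    hence nonneg: "B $ i $ j \<ge> 0" for i j by (simp add: stochastic_magic_squares_def)
    have BZ: "B $ i $ j \<in> \<int>" for i j using int B by (simp add: integral_polytope_def)
    assume "\<not> f B \<ge> 1"
    moreover have "f B \<in> \<int>" unfolding f_def by (intro Ints_sum BZ)
    moreover have "f B \<ge> 0" unfolding f_def by (intro sum_nonneg nonneg)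
    ultimately have "f B = 0" by (auto elim!: Ints_cases)
    hence "\<forall>x\<in>?Z. B $ fst x $ snd x = 0"
      unfolding f_def by (subst (asm) sum_nonneg_eq_0_iff) (auto simp: nonneg)
    with face[OF BP] BZ show False by auto
  qed
  moreover have "convex {B. f B \<ge> 1}"
  proof -
    have "f (u *\<^sub>R B + v *\<^sub>R C) = u * f B + v * f C" for u v B C
      by (simp add: f_def sum.distrib flip: sum_distrib_left)
    moreover have "1 \<le> u * x + v * y" if "1 \<le> x" "1 \<le> y" "0 \<le> u" "0 \<le> v" "u + v = 1"
      for u v x y :: real
      using that mult_left_mono[of 1 x u] mult_left_mono[of 1 y v] by linarith
    ultimately show ?thesis by (simp add: convex_def)
  qed
  ultimately have "convex hull {B. B extreme_point_of ?P} \<subseteq> {B. f B \<ge> 1}"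
    by (intro hull_minimal) auto
  moreover have "?P = convex hull {B. B extreme_point_of ?P}"
    by (intro Krein_Milman_Minkowski convex_stochastic)
       (simp add: compact_eq_bounded_closed bounded_stochastic closed_stochastic)
  ultimately have "f A \<ge> 1" using A by auto
  thus False by (simp add: f_def)
qed

lemma not_integral_if_nat_matrix:
  fixes V :: "nat \<Rightarrow> nat \<Rightarrow> real"
  defines "n \<equiv> CARD('n::{finite,linorder})"
  assumes V: "line_sums n V 1" "\<And>k l. k < n \<Longrightarrow> l < n \<Longrightarrow> V k l \<ge> 0"
    and face: "\<And>B :: nat \<Rightarrow> nat \<Rightarrow> real. line_sums n B 1 \<Longrightarrow> (\<And>k l. k < n \<Longrightarrow> l < n \<Longrightarrow> V k l = 0 \<Longrightarrow> B k l = 0) \<Longrightarrow>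
      \<exists>k<n. \<exists>l<n. B k l \<notin> \<int>"
  shows "\<not> integral_polytope (stochastic_magic_squares :: (real, 'n) square_matrix set)"
proof (rule not_integral_if_face_not_integral)
  let ?A = "(\<chi> i j. V (rank_of i) (rank_of j)) :: (real, 'n) square_matrix"
  show "?A \<in> stochastic_magic_squares"
    using V by (simp add: stochastic_magic_squares_def all_line_sums_of_nat_matrix n_def)
  fix B :: "(real, 'n) square_matrix"
  assume B: "B \<in> stochastic_magic_squares" "\<And>i j. ?A $ i $ j = 0 \<Longrightarrow> B $ i $ j = 0"
  have "\<exists>k<n. \<exists>l<n. B $ idx k $ idx l \<notin> \<int>"
    using B by (intro face[of "\<lambda>k l. B $ idx k $ idx l"]) (auto simp: stochastic_magic_squares_def
        all_line_sums_idx n_def)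
  thus "\<exists>i j. B $ i $ j \<notin> \<int>" by blast
qed

section \<open>Faces without integral points, by size\<close>

lemma reciprocal_not_Ints:
  fixes x :: real
  assumes "of_nat m * x = 1" "m > 1"
  shows "x \<notin> \<int>"
proof
  assume "x \<in> \<int>"
  then obtain z where "x = of_int z" by (elim Ints_cases)
  with assms(1) have "of_int (int m * z) = (1 :: real)" by simp
  hence "int m * z = 1" by (simp only: of_int_eq_1_iff)
  hence "int m dvd 1" by (metis dvd_triv_left)
  with assms(2) show False by simp
qed

text \<open>Adding both diagonals and the middle column and subtracting the first and last row
  leaves three times the centre, which is therefore \<open>1 / 3\<close> everywhere on the polytope.
  The face is the whole polytope, since the constant matrix has no zeros.\<close>

lemma not_integral_3:
  assumes "CARD('n::{finite,linorder}) = 3"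
  shows "\<not> integral_polytope (stochastic_magic_squares :: (real, 'n) square_matrix set)"
proof (rule not_integral_if_nat_matrix[where V = "\<lambda>_ _. 1 / 3"], unfold assms)
  fix B :: "nat \<Rightarrow> nat \<Rightarrow> real"
  assume "line_sums 3 B 1"
  hence "of_nat 3 * B 1 1 = 1"
    by (simp add: line_sums_def numeral_3_eq_3 lessThan_Suc All_less_Suc)
  hence "B 1 1 \<notin> \<int>" by (rule reciprocal_not_Ints) simp
  thus "\<exists>k<3. \<exists>l<3. B k l \<notin> \<int>" by (intro exI[of _ "1::nat"] conjI) simp_all
qed (simp_all add: line_sums_def)

lemma not_integral_4:
  assumes "CARD('n::{finite,linorder}) = 4"
  shows "\<not> integral_polytope (stochastic_magic_squares :: (real, 'n) square_matrix set)"
proof (rule not_integral_if_nat_matrix, unfold assms)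
  \<comment> \<open>The support is chosen so that the top row and column 1 have only one position
    each besides \<open>(0, 1)\<close>, namely \<open>(0, 0)\<close> and \<open>(1, 1)\<close>, and
    that these two are the only ones on the main diagonal. Their entries are thus equal and sum to
    1.\<close>
  let ?V = "\<lambda>k l. [[1/2, 1/2, 0, 0], [0, 1/2, 1/2, 0], [0, 0, 0, 1], [1/2, 0, 1/2, 0]] ! k ! l :: real"
  show "line_sums 4 ?V 1"
    by (simp add: line_sums_def eval_nat_numeral lessThan_Suc All_less_Suc)
  show "?V k l \<ge> 0" if "k < 4" "l < 4" for k l
    using that by (auto simp: eval_nat_numeral less_Suc_eq)
  fix B :: "nat \<Rightarrow> nat \<Rightarrow> real"
  assume B: "line_sums 4 B 1" "\<And>k l. k < 4 \<Longrightarrow> l < 4 \<Longrightarrow> ?V k l = 0 \<Longrightarrow> B k l = 0"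
  have "B 0 2 = 0" "B 0 3 = 0" "B 1 0 = 0" "B 1 3 = 0" "B 2 0 = 0" "B 2 1 = 0" "B 2 2 = 0"
    "B 3 1 = 0" "B 3 3 = 0"
    by (rule B(2); simp)+
  hence "of_nat 2 * B 0 0 = 1"
    using B(1) by (simp add: line_sums_def eval_nat_numeral lessThan_Suc All_less_Suc)
  hence "B 0 0 \<notin> \<int>" by (rule reciprocal_not_Ints) simp
  thus "\<exists>k<4. \<exists>l<4. B k l \<notin> \<int>" by (intro exI[of _ "0::nat"] conjI) simp_all
qed

lemma not_integral_5:
  assumes "CARD('n::{finite,linorder}) = 5"
  shows "\<not> integral_polytope (stochastic_magic_squares :: (real, 'n) square_matrix set)"
proof (rule not_integral_if_nat_matrix, unfold assms)
  \<comment> \<open>The top row, column 1 and the main diagonal have the same support as in size 4,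
    so the same argument applies.\<close>
  let ?V = "\<lambda>k l. [[1/2, 1/2, 0, 0, 0], [0, 1/2, 0, 1/2, 0], [0, 0, 0, 1/2, 1/2],
    [0, 0, 1/2, 0, 1/2], [1/2, 0, 1/2, 0, 0]] ! k ! l :: real"
  show "line_sums 5 ?V 1"
    by (simp add: line_sums_def eval_nat_numeral lessThan_Suc All_less_Suc)
  show "?V k l \<ge> 0" if "k < 5" "l < 5" for k l
    using that by (auto simp: eval_nat_numeral less_Suc_eq)
  fix B :: "nat \<Rightarrow> nat \<Rightarrow> real"
  assume B: "line_sums 5 B 1" "\<And>k l. k < 5 \<Longrightarrow> l < 5 \<Longrightarrow> ?V k l = 0 \<Longrightarrow> B k l = 0"
  have "B 0 2 = 0" "B 0 3 = 0" "B 0 4 = 0" "B 1 0 = 0" "B 1 2 = 0" "B 1 4 = 0" "B 2 0 = 0"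
    "B 2 1 = 0" "B 2 2 = 0" "B 3 0 = 0" "B 3 1 = 0" "B 3 3 = 0" "B 4 1 = 0" "B 4 3 = 0" "B 4 4 = 0"
    by (rule B(2); simp)+
  hence "of_nat 2 * B 0 0 = 1"
    using B(1) by (simp add: line_sums_def eval_nat_numeral lessThan_Suc All_less_Suc)
  hence "B 0 0 \<notin> \<int>" by (rule reciprocal_not_Ints) simp
  thus "\<exists>k<5. \<exists>l<5. B k l \<notin> \<int>" by (intro exI[of _ "0::nat"] conjI) simp_all
qed

lemma sum_indicator_lessThan:
  fixes w :: real
  assumes "S \<subseteq> {..<n}"
  shows "(\<Sum>l<n. if l \<in> S then 0 else w) = w * (real n - real (card S))"
proof -
  have "(\<Sum>l<n. if l \<in> S then 0 else w) = (\<Sum>l\<in>{..<n} - S. w)"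
    by (rule sum.mono_neutral_cong_right) auto
  also have "\<dots> = real (n - card S) * w" using assms by (simp add: card_Diff_subset finite_subset)
  finally show ?thesis using assms card_mono[OF _ assms] by (simp add: of_nat_diff)
qed

text \<open>The four corners are \<open>1/2\<close> and all other entries on the border and on the diagonals vanish, so that any
  square vanishing there has corners \<open>1/2\<close>, too. For odd \<open>n\<close> the middle row and column have one zero less
  than the other inner ones and need their own weight.\<close>

definition hollow :: "nat \<Rightarrow> nat \<Rightarrow> nat \<Rightarrow> real" where
  "hollow n k l =
    (if k \<in> {0, n - 1} \<and> l \<in> {0, n - 1} then 1 / 2
     else if k \<in> {0, n - 1} \<or> l \<in> {0, n - 1} \<or> l = k \<or> k + l = n - 1 then 0
     else if even n then 1 / (real n - 4)
     else if 2 * k = n - 1 \<or> 2 * l = n - 1 then 1 / (real n - 3)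
     else (1 - 1 / (real n - 3)) / (real n - 5))"

lemma sum_row_corners:
  fixes n :: nat
  assumes "n \<ge> 2"
  shows "(\<Sum>l<n. if l \<in> {0, n - 1} then 1 / 2 else 0 :: real) = 1"
proof -
  have "(\<Sum>l<n. if l \<in> {0, n - 1} then 1 / 2 else 0 :: real) = (\<Sum>l\<in>{0, n - 1}. 1 / 2)"
    by (rule sum.mono_neutral_cong_right) (use assms in auto)
  thus ?thesis using assms by simp
qed

lemma hollow_row_sum:
  assumes n: "n \<ge> 6" and k: "k < n"
  shows "(\<Sum>l<n. hollow n k l) = 1"
proof -
  consider "k \<in> {0, n - 1}" | "k \<notin> {0, n - 1}" "even n" | "k \<notin> {0, n - 1}" "odd n" "2 * k = n - 1"
    | "k \<notin> {0, n - 1}" "odd n" "2 * k \<noteq> n - 1" by blast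
  thus ?thesis
  proof cases
    case 1
    hence "(\<Sum>l<n. hollow n k l) = (\<Sum>l<n. if l \<in> {0, n - 1} then 1 / 2 else 0)"
      by (intro sum.cong) (auto simp: hollow_def)
    thus ?thesis using sum_row_corners n by simp
  next
    case 2
    let ?S = "{0, n - 1, k, n - 1 - k}"
    have S: "?S \<subseteq> {..<n}" "card ?S = 4"
      using 2 k n by (auto simp: card_insert_if) presburger+
    have "(\<Sum>l<n. hollow n k l) = (\<Sum>l<n. if l \<in> ?S then 0 else 1 / (real n - 4))"
      using 2 k by (intro sum.cong) (auto simp: hollow_def)
    also have "\<dots> = 1" using S n by (subst sum_indicator_lessThan) auto
    finally show ?thesis .
  next
    case 3
    let ?S = "{0, n - 1, k}"
    have S: "?S \<subseteq> {..<n}" "card ?S = 3"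
      using 3 k n by (auto simp: card_insert_if)
    have "(\<Sum>l<n. hollow n k l) = (\<Sum>l<n. if l \<in> ?S then 0 else 1 / (real n - 3))"
      using 3 k by (intro sum.cong) (auto simp: hollow_def)
    also have "\<dots> = 1" using S n by (subst sum_indicator_lessThan) auto
    finally show ?thesis .
  next
    case 4
    define c where "c = (n - 1) div 2"
    have c: "2 * c = n - 1" using 4 by (auto simp: c_def elim!: oddE)
    \<comment> \<open>Four of these positions carry zeros. The fifth, in the middle column
      \<open>c\<close>, has its own weight and is added back, so that \<open>n - 5\<close> positions
      share what remains.\<close>
    let ?S = "{0, n - 1, k, n - 1 - k, c}"
    let ?w = "(1 - 1 / (real n - 3)) / (real n - 5)"
    have S: "?S \<subseteq> {..<n}" "card ?S = 5"
      using 4 k n c by (auto simp: card_insert_if)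
    have "n \<noteq> 6" using 4 by auto
    hence n7: "n \<ge> 7" using n by simp
    have "(\<Sum>l<n. hollow n k l)
        = (\<Sum>l<n. (if l \<in> ?S then 0 else ?w) + (if l = c then 1 / (real n - 3) else 0))"
      using 4 k c n by (intro sum.cong) (auto simp: hollow_def)
    also have "\<dots> = ?w * (real n - 5) + 1 / (real n - 3)"
      using S n by (subst sum.distrib, subst sum_indicator_lessThan) auto
    also have "\<dots> = 1" using n7 by simp
    finally show ?thesis .
  qed
qed

lemma hollow_sym: "hollow n k l = hollow n l k"
  by (auto simp: hollow_def add.commute)

lemma not_integral_ge_6:
  assumes "CARD('n::{finite,linorder}) \<ge> 6"
  shows "\<not> integral_polytope (stochastic_magic_squares :: (real, 'n) square_matrix set)"
proof (rule not_integral_if_nat_matrix)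
  define n where "n = CARD('n)"
  note n = assms[folded n_def]
  have "(\<Sum>k<n. hollow n k k) = (\<Sum>k<n. if k \<in> {0, n - 1} then 1 / 2 else 0)"
    by (intro sum.cong) (auto simp: hollow_def)
  moreover have "(\<Sum>k<n. hollow n k (n - 1 - k)) = (\<Sum>k<n. if k \<in> {0, n - 1} then 1 / 2 else 0)"
    by (intro sum.cong) (auto simp: hollow_def)
  moreover have "(\<Sum>k<n. hollow n k l) = 1" if "l < n" for l
    using hollow_row_sum[OF n that] by (subst hollow_sym)
  ultimately show "line_sums CARD('n) (hollow n) 1"
    using n hollow_row_sum sum_row_corners[of n] by (simp add: line_sums_def flip: n_def)
  show "hollow n k l \<ge> 0" for k l
    using n by (auto simp: hollow_def divide_le_eq intro!: divide_nonneg_nonneg)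
  fix B :: "nat \<Rightarrow> nat \<Rightarrow> real"
  assume "line_sums CARD('n) B 1" "\<And>k l. k < CARD('n) \<Longrightarrow> l < CARD('n) \<Longrightarrow> hollow n k l = 0 \<Longrightarrow> B k l = 0"
  note B = this[folded n_def]
  have border: "(\<Sum>l<n. f l) = f 0 + f (n - 1)" if "\<And>l. l < n \<Longrightarrow> l \<notin> {0, n - 1} \<Longrightarrow> f l = 0"
    for f :: "nat \<Rightarrow> real"
  proof -
    have "(\<Sum>l<n. f l) = (\<Sum>l\<in>{0, n - 1}. f l)"
      by (rule sum.mono_neutral_right) (use that n in auto)
    thus ?thesis using n by simp
  qed
  \<comment> \<open>The top row plus the left column minus the secondary diagonal isolates
    \<open>2 * B 0 0\<close>.\<close>
  have "(\<Sum>l<n. B 0 l) = B 0 0 + B 0 (n - 1)"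
    by (intro border B(2)) (use n in \<open>auto simp: hollow_def\<close>)
  moreover have "(\<Sum>k<n. B k 0) = B 0 0 + B (n - 1) 0"
    by (intro border B(2)) (use n in \<open>auto simp: hollow_def\<close>)
  moreover have "(\<Sum>k<n. B k (n - 1 - k)) = B 0 (n - 1 - 0) + B (n - 1) (n - 1 - (n - 1))"
    by (intro border B(2)) (use n in \<open>auto simp: hollow_def\<close>)
  ultimately have "of_nat 2 * B 0 0 = B 0 0 + B 0 0" "B 0 0 + B 0 (n - 1) = 1"
     "B 0 0 + B (n - 1) 0 = 1" "B 0 (n - 1) + B (n - 1) 0 = 1"
    using B(1) n by (auto simp: line_sums_def)
  hence "of_nat 2 * B 0 0 = 1" by linarith
  hence "B 0 0 \<notin> \<int>" by (rule reciprocal_not_Ints) simp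
  thus "\<exists>k<CARD('n). \<exists>l<CARD('n). B k l \<notin> \<int>"
    using n by (intro exI[of _ "0::nat"] conjI) simp_all
qed

lemma not_integral:
  assumes "CARD('n::{finite,linorder}) > 2"
  shows "\<not> integral_polytope (stochastic_magic_squares :: (real, 'n) square_matrix set)"
proof -
  consider "CARD('n) = 3" | "CARD('n) = 4" | "CARD('n) = 5" | "CARD('n) \<ge> 6"
    using assms by linarith
  thus ?thesis
    by cases (rule not_integral_3 not_integral_4 not_integral_5 not_integral_ge_6; assumption)+
qed

section \<open>Magic squares as pairs of shells\<close>

definition transports :: "nat \<Rightarrow> nat \<Rightarrow> nat \<Rightarrow> nat \<Rightarrow> (nat \<times> nat \<times> nat \<times> nat) set" where
  "transports r r' c c' = {(w1, w2, w3, w4). w1 + w2 = r \<and> w3 + w4 = r' \<and> w1 + w3 = c \<and> w2 + w4 = c'}"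

text \<open>The entry \<open>w1\<close> determines the table and ranges from \<open>c - r'\<close>
  to \<open>min r c\<close>. Equal totals make the length of this interval symmetric in the four
  margins.\<close>

lemma card_transports:
  assumes "r + r' = c + c'"
  shows "card (transports r r' c c') = Suc (min (min r r') (min c c'))"
proof -
  have "bij_betw (\<lambda>w. (w, r - w, c - w, r' - (c - w))) {c - r'..min r c} (transports r r' c c')"
    by (rule bij_betw_byWitness[where f' = fst]) (use assms in \<open>auto simp: transports_def\<close>)
  from bij_betw_same_card[OF this] have "card (transports r r' c c') = Suc (min r c) - (c - r')"
    by simp
  thus ?thesis using assms by linarith
qed

lemma finite_transports: "finite (transports r r' c c')"
  by (rule finite_subset[of _ "{..r} \<times> {..r} \<times> {..r'} \<times> {..r'}"]) (auto simp: transports_def)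

text \<open>\<open>P\<close>, \<open>P'\<close>, \<open>C\<close> and \<open>R\<close> are the sums of the two shell entries on the main diagonal, the secondary
  diagonal, the middle column and the middle row; \<open>x\<close>, \<open>y\<close>, \<open>c\<close> and \<open>r\<close> are the top left, top right, top
  and left entries. The two rows of the shell must leave room for at least \<open>k\<close>, its two columns for at
  least \<open>l\<close>. Size 4 is the case \<open>C = R = 0\<close>.\<close>

definition shell :: "nat \<Rightarrow> nat \<Rightarrow> nat \<Rightarrow> nat \<Rightarrow> nat \<Rightarrow> nat \<Rightarrow> nat \<Rightarrow> (nat \<times> nat \<times> nat \<times> nat) set" where
  "shell s P P' C R k l = {(x, y, c, r). x \<le> P \<and> y \<le> P' \<and> c \<le> C \<and> r \<le> R \<and>
     x + y + c + k \<le> s \<and> (P - x) + (P' - y) + (C - c) + k \<le> s \<and>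
     x + (P' - y) + r + l \<le> s \<and> (P - x) + y + (R - r) + l \<le> s}"

type_synonym quad = "nat \<times> nat \<times> nat \<times> nat"

text \<open>What the upper and lower row and the left and right column of the shell leave of the
  magic sum; these numbers are the margins of the blocks.\<close>

fun row_room1 row_room2 col_room1 col_room2 :: "nat \<Rightarrow> nat \<Rightarrow> nat \<Rightarrow> nat \<Rightarrow> nat \<Rightarrow> quad \<Rightarrow> nat" where
  "row_room1 s P P' C R (x, y, c, r) = s - (x + y + c)"
| "row_room2 s P P' C R (x, y, c, r) = s - ((P - x) + (P' - y) + (C - c))"
| "col_room1 s P P' C R (x, y, c, r) = s - (x + (P' - y) + r)"
| "col_room2 s P P' C R (x, y, c, r) = s - ((P - x) + y + (R - r))"

lemmas room_simps = row_room1.simps row_room2.simps col_room1.simps col_room2.simps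

text \<open>On the shell without thresholds the rooms are genuine differences, so that
  \<open>u + k \<le> s\<close> becomes \<open>k \<le> s - u\<close>. Then \<open>k\<close> concerns
  only the smaller of the two row rooms, and \<open>l\<close> the smaller of the two column
  rooms.\<close>

lemma shell_eq_room:
  "shell s P P' C R k l = {a \<in> shell s P P' C R 0 0.
     k \<le> min (row_room1 s P P' C R a) (row_room2 s P P' C R a) \<and>
     l \<le> min (col_room1 s P P' C R a) (col_room2 s P P' C R a)}"
proof (rule set_eqI)
  fix a :: quad
  obtain x y c r where a: "a = (x, y, c, r)" by (cases a)
  have room: "u + k \<le> s \<longleftrightarrow> u \<le> s \<and> k \<le> s - u" for u k :: nat by arith
  show "a \<in> shell s P P' C R k l \<longleftrightarrow> a \<in> {a \<in> shell s P P' C R 0 0.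
     k \<le> min (row_room1 s P P' C R a) (row_room2 s P P' C R a) \<and>
     l \<le> min (col_room1 s P P' C R a) (col_room2 s P P' C R a)}"
    unfolding a shell_def mem_Collect_eq prod.case room_simps min.bounded_iff add_0_right
      room[of "x + y + c"] room[of "(P - x) + (P' - y) + (C - c)"]
      room[of "x + (P' - y) + r"] room[of "(P - x) + y + (R - r)"]
    by blast
qed

lemma finite_shell: "finite (shell s P P' C R k l)"
  by (rule finite_subset[of _ "{..P} \<times> {..P'} \<times> {..C} \<times> {..R}"]) (auto simp: shell_def)

lemma room_sums:
  assumes "a \<in> shell s P P' C R 0 0"
  shows "row_room1 s P P' C R a + row_room2 s P P' C R a = 2 * s - (P + P' + C)"
    and "col_room1 s P P' C R a + col_room2 s P P' C R a = 2 * s - (P + P' + R)"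
proof -
  obtain x y c r where a: "a = (x, y, c, r)" by (cases a)
  have le: "x \<le> P" "y \<le> P'" "c \<le> C" "r \<le> R" using assms by (auto simp: a shell_def)
  then obtain x' y' c' r' where d: "P = x + x'" "P' = y + y'" "C = c + c'" "R = r + r'"
    by (metis le_iff_add)
  show "row_room1 s P P' C R a + row_room2 s P P' C R a = 2 * s - (P + P' + C)"
    "col_room1 s P P' C R a + col_room2 s P P' C R a = 2 * s - (P + P' + R)"
    using assms unfolding a d by (simp_all add: shell_def)
qed

text \<open>The first block lies in the rows of the outer shell and the columns of the inner one,
  the second block the other way round.\<close>

definition fillings ::
  "nat \<Rightarrow> nat \<Rightarrow> nat \<Rightarrow> nat \<Rightarrow> nat \<Rightarrow> nat \<Rightarrow> nat \<Rightarrow> nat \<Rightarrow> nat \<Rightarrow> ((quad \<times> quad) \<times> quad \<times> quad) set" where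
  "fillings s P P' C R Q Q' D T =
     (SIGMA (a, b) : shell s P P' C R 0 0 \<times> shell s Q Q' D T 0 0.
       transports (row_room1 s P P' C R a) (row_room2 s P P' C R a)
                  (col_room1 s Q Q' D T b) (col_room2 s Q Q' D T b) \<times>
       transports (row_room1 s Q Q' D T b) (row_room2 s Q Q' D T b)
                  (col_room1 s P P' C R a) (col_room2 s P P' C R a))"

lemma sum_if_le: "m \<le> s \<Longrightarrow> (\<Sum>k\<le>s. if k \<le> m then 1 else 0) = Suc m" for m s :: nat
proof -
  assume "m \<le> s"
  hence "{..s} \<inter> {k. k \<le> m} = {..m}" by auto
  thus ?thesis by (simp flip: sum.inter_restrict add: sum.If_cases)
qed

lemma sum_swap3:
  "(\<Sum>a\<in>A. \<Sum>k\<in>K. \<Sum>l\<in>L. g a k l) = (\<Sum>k\<in>K. \<Sum>l\<in>L. \<Sum>a\<in>A. g a k l)"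
  by (subst sum.swap, rule sum.cong[OF refl], rule sum.swap)

lemma card_if: "finite S \<Longrightarrow> card {a \<in> S. Q a} = (\<Sum>a\<in>S. if Q a then 1 else 0)"
  by (simp add: sum.If_cases Int_def)

text \<open>Both factors \<open>1 + min\<close> are written as numbers of thresholds, which decouples the two shells.\<close>

lemma card_fillings:
  assumes "P + P' + C = Q + Q' + T" "Q + Q' + D = P + P' + R"
  shows "card (fillings s P P' C R Q Q' D T)
     = (\<Sum>k\<le>s. \<Sum>l\<le>s. card (shell s P P' C R k l) * card (shell s Q Q' D T l k))"
proof -
  let ?S = "shell s P P' C R 0 0" and ?S' = "shell s Q Q' D T 0 0"
  define h v where "h = (\<lambda>a. min (row_room1 s P P' C R a) (row_room2 s P P' C R a))"
    and "v = (\<lambda>a. min (col_room1 s P P' C R a) (col_room2 s P P' C R a))"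
  define h' v' where "h' = (\<lambda>a. min (row_room1 s Q Q' D T a) (row_room2 s Q Q' D T a))"
    and "v' = (\<lambda>a. min (col_room1 s Q Q' D T a) (col_room2 s Q Q' D T a))"
  note hv = h_def v_def h'_def v'_def
  let ?i = "\<lambda>b. if b then 1 else 0 :: nat"
  have le: "h a \<le> s" "v a \<le> s" for a
    by (cases a; simp add: hv min.coboundedI1)+
  have sh: "shell s P P' C R k l = {a \<in> ?S. k \<le> h a \<and> l \<le> v a}" for k l
    unfolding hv by (rule shell_eq_room)
  have sh': "shell s Q Q' D T l k = {b \<in> ?S'. l \<le> h' b \<and> k \<le> v' b}" for k l
    unfolding hv by (rule shell_eq_room)
  have cs: "card (shell s P P' C R k l) = (\<Sum>a\<in>?S. ?i (k \<le> h a) * ?i (l \<le> v a))" for k l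
    by (subst sh, subst card_if) (auto simp: finite_shell intro!: sum.cong)
  have cs': "card (shell s Q Q' D T l k) = (\<Sum>b\<in>?S'. ?i (l \<le> h' b) * ?i (k \<le> v' b))" for k l
    by (subst sh', subst card_if) (auto simp: finite_shell intro!: sum.cong)
  have "card (fillings s P P' C R Q Q' D T)
      = (\<Sum>(a, b)\<in>?S \<times> ?S'.
          card (transports (row_room1 s P P' C R a) (row_room2 s P P' C R a)
                  (col_room1 s Q Q' D T b) (col_room2 s Q Q' D T b)) *
          card (transports (row_room1 s Q Q' D T b) (row_room2 s Q Q' D T b)
                  (col_room1 s P P' C R a) (col_room2 s P P' C R a)))"
    unfolding fillings_def
    by (subst card_SigmaI)
       (simp_all add: finite_shell finite_transports case_prod_unfold card_cartesian_product)
  also have "\<dots> = (\<Sum>(a, b)\<in>?S \<times> ?S'. Suc (min (h a) (v' b)) * Suc (min (h' b) (v a)))"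
  proof (rule sum.cong[OF refl], clarify)
    fix x y c r x' y' c' r' :: nat
    assume a: "(x, y, c, r) \<in> ?S" and b: "(x', y', c', r') \<in> ?S'"
    let ?a = "(x, y, c, r)" and ?b = "(x', y', c', r')"
    \<comment> \<open>The two assumptions make the row margins and the column margins of each block
      equal in total, as \<open>card_transports\<close> requires.\<close>
    have "row_room1 s P P' C R ?a + row_room2 s P P' C R ?a
        = col_room1 s Q Q' D T ?b + col_room2 s Q Q' D T ?b"
      "row_room1 s Q Q' D T ?b + row_room2 s Q Q' D T ?b
        = col_room1 s P P' C R ?a + col_room2 s P P' C R ?a"
      by (simp_all only: room_sums[OF a] room_sums[OF b] assms)
    thus "card (transports (row_room1 s P P' C R ?a) (row_room2 s P P' C R ?a)
                  (col_room1 s Q Q' D T ?b) (col_room2 s Q Q' D T ?b)) *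
          card (transports (row_room1 s Q Q' D T ?b) (row_room2 s Q Q' D T ?b)
                  (col_room1 s P P' C R ?a) (col_room2 s P P' C R ?a))
        = Suc (min (h ?a) (v' ?b)) * Suc (min (h' ?b) (v ?a))"
      by (simp only: card_transports hv)
  qed
  also have "\<dots> = (\<Sum>(a, b)\<in>?S \<times> ?S'. (\<Sum>k\<le>s. ?i (k \<le> h a) * ?i (k \<le> v' b)) *
      (\<Sum>l\<le>s. ?i (l \<le> v a) * ?i (l \<le> h' b)))"
  proof (intro sum.cong refl, clarify)
    fix a1 a2 a3 a4 b1 b2 b3 b4 :: nat
    let ?a = "(a1, a2, a3, a4)" and ?b = "(b1, b2, b3, b4)"
    \<comment> \<open>A product of two indicators is the indicator of the minimum. The thresholds
      start at 0, which accounts for \<open>Suc\<close>, and the rooms never exceed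
      \<open>s\<close>.\<close>
    have sum_i: "(\<Sum>k\<le>s. ?i (k \<le> m) * ?i (k \<le> m')) = Suc (min m m')" if "m \<le> s" for m m'
    proof -
      have "(\<Sum>k\<le>s. ?i (k \<le> m) * ?i (k \<le> m')) = (\<Sum>k\<le>s. ?i (k \<le> min m m'))"
        by (intro sum.cong) auto
      also have "\<dots> = Suc (min m m')" using that by (intro sum_if_le) simp
      finally show ?thesis .
    qed
    show "Suc (min (h ?a) (v' ?b)) * Suc (min (h' ?b) (v ?a)) =
      (\<Sum>k\<le>s. ?i (k \<le> h ?a) * ?i (k \<le> v' ?b)) * (\<Sum>l\<le>s. ?i (l \<le> v ?a) * ?i (l \<le> h' ?b))"
      by (simp only: sum_i[OF le(1)] sum_i[OF le(2)] min.commute)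
  qed
  also have "\<dots> = (\<Sum>a\<in>?S. \<Sum>b\<in>?S'. \<Sum>k\<le>s. \<Sum>l\<le>s.
      (?i (k \<le> h a) * ?i (l \<le> v a)) * (?i (l \<le> h' b) * ?i (k \<le> v' b)))"
    by (simp only: sum.cartesian_product[symmetric] sum_product, intro sum.cong refl)
       (simp only: ac_simps)
  also have "\<dots> = (\<Sum>k\<le>s. \<Sum>l\<le>s. \<Sum>a\<in>?S. \<Sum>b\<in>?S'.
      (?i (k \<le> h a) * ?i (l \<le> v a)) * (?i (l \<le> h' b) * ?i (k \<le> v' b)))"
    by (simp only: sum_swap3[where A = ?S'] sum_swap3[where A = ?S])
  also have "\<dots> = (\<Sum>k\<le>s. \<Sum>l\<le>s. card (shell s P P' C R k l) * card (shell s Q Q' D T l k))"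
    by (intro sum.cong refl) (simp only: cs cs' sum_product)
  finally show ?thesis .
qed

section \<open>Magic squares and block fillings\<close>

lemma room_iff: "u \<le> s \<and> w = s - u \<longleftrightarrow> u + w = s" for u :: nat
  by arith

text \<open>Writing every shell sum as an entry plus its mirror image removes all subtractions, and
  membership turns into the row and column equations of the square, apart from those of the middle
  row and column.\<close>

lemma fillings_add_iff:
  "(((x, y, c, r), (x', y', c', r')), (w1, w2, w3, w4), (v1, v2, v3, v4)) \<in>
     fillings s (x + xx) (y + yy) (c + cc) (r + rr) (x' + xx') (y' + yy') (c' + cc') (r' + rr') \<longleftrightarrow>
   (x + y + c) + (w1 + w2) = s \<and> (xx + yy + cc) + (w3 + w4) = s \<and>
   (x + yy + r) + (v1 + v3) = s \<and> (xx + y + rr) + (v2 + v4) = s \<and>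
   (x' + y' + c') + (v1 + v2) = s \<and> (xx' + yy' + cc') + (v3 + v4) = s \<and>
   (x' + yy' + r') + (w1 + w3) = s \<and> (xx' + y' + rr') + (w2 + w4) = s"
  unfolding room_iff[symmetric] fillings_def shell_def transports_def mem_Sigma_iff mem_Times_iff fst_conv snd_conv
    mem_Collect_eq prod.case room_simps add_0_right add_diff_cancel_left'
  by (simp only: le_add1 simp_thms) blast

lemma fillings_cases:
  assumes "f \<in> fillings s P P' C R Q Q' D T"
  obtains x y c r x' y' c' r' w1 w2 w3 w4 v1 v2 v3 v4 xx yy cc rr xx' yy' cc' rr'
  where "f = (((x, y, c, r), (x', y', c', r')), (w1, w2, w3, w4), (v1, v2, v3, v4))"
    "P = x + xx" "P' = y + yy" "C = c + cc" "R = r + rr"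
    "Q = x' + xx'" "Q' = y' + yy'" "D = c' + cc'" "T = r' + rr'"
proof -
  obtain x y c r x' y' c' r' w1 w2 w3 w4 v1 v2 v3 v4
    where f: "f = (((x, y, c, r), (x', y', c', r')), (w1, w2, w3, w4), (v1, v2, v3, v4))"
    by (cases f) auto
  have "x \<le> P" "y \<le> P'" "c \<le> C" "r \<le> R" "x' \<le> Q" "y' \<le> Q'" "c' \<le> D" "r' \<le> T"
    using assms by (auto simp: f fillings_def shell_def)
  thus thesis by (metis f that le_iff_add)
qed

definition matrix_of_rows :: "'a list list \<Rightarrow> ('a, 'n::{finite,linorder}) square_matrix" where
  "matrix_of_rows xss = (\<chi> i j. xss ! rank_of i ! rank_of j)"

lemma matrix_of_rows_idx:
  "k < CARD('n) \<Longrightarrow> l < CARD('n) \<Longrightarrow>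
     (matrix_of_rows xss :: ('a, 'n::{finite,linorder}) square_matrix) $ idx k $ idx l = xss ! k ! l"
  by (simp add: matrix_of_rows_def)

lemma matrix_eq_idx:
  fixes A B :: "('a, 'n::{finite,linorder}) square_matrix"
  shows "A = B \<longleftrightarrow> (\<forall>k<CARD('n). \<forall>l<CARD('n). A $ idx k $ idx l = B $ idx k $ idx l)"
  by (metis (no_types, lifting) idx_rank rank_lt_card vec_eq_iff)

lemma line_sums_4_iff:
  "line_sums 4 a s \<longleftrightarrow>
   (a 0 0 + a 0 1 + a 0 2 + a 0 3 = s) \<and> (a 1 0 + a 1 1 + a 1 2 + a 1 3 = s) \<and> (a 2 0 + a 2 1 + a 2 2 + a 2 3 = s) \<and>
   (a 3 0 + a 3 1 + a 3 2 + a 3 3 = s) \<and> (a 0 0 + a 1 0 + a 2 0 + a 3 0 = s) \<and> (a 0 1 + a 1 1 + a 2 1 + a 3 1 = s) \<and>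
   (a 0 2 + a 1 2 + a 2 2 + a 3 2 = s) \<and> (a 0 3 + a 1 3 + a 2 3 + a 3 3 = s) \<and> (a 0 0 + a 1 1 + a 2 2 + a 3 3 = s) \<and>
   (a 0 3 + a 1 2 + a 2 1 + a 3 0 = s)"
  by (simp add: line_sums_def eval_nat_numeral lessThan_Suc All_less_Suc ac_simps)

lemma line_sums_5_iff:
  "line_sums 5 a s \<longleftrightarrow>
   (a 0 0 + a 0 1 + a 0 2 + a 0 3 + a 0 4 = s) \<and> (a 1 0 + a 1 1 + a 1 2 + a 1 3 + a 1 4 = s) \<and> (a 2 0 + a 2 1 +
       a 2 2 + a 2 3 + a 2 4 = s) \<and>
   (a 3 0 + a 3 1 + a 3 2 + a 3 3 + a 3 4 = s) \<and> (a 4 0 + a 4 1 + a 4 2 + a 4 3 + a 4 4 = s) \<and> (a 0 0 + a 1 0 +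
       a 2 0 + a 3 0 + a 4 0 = s) \<and>
   (a 0 1 + a 1 1 + a 2 1 + a 3 1 + a 4 1 = s) \<and> (a 0 2 + a 1 2 + a 2 2 + a 3 2 + a 4 2 = s) \<and> (a 0 3 + a 1 3 +
       a 2 3 + a 3 3 + a 4 3 = s) \<and>
   (a 0 4 + a 1 4 + a 2 4 + a 3 4 + a 4 4 = s) \<and> (a 0 0 + a 1 1 + a 2 2 + a 3 3 + a 4 4 = s) \<and> (a 0 4 + a 1 3 +
       a 2 2 + a 3 1 + a 4 0 = s)"
  by (simp add: line_sums_def eval_nat_numeral lessThan_Suc All_less_Suc ac_simps)

lemma matrix_of_rows_magic:
  "(matrix_of_rows xss :: (nat, 'n::{finite,linorder}) square_matrix) \<in> magic_squares s \<longleftrightarrow>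
     line_sums CARD('n) (\<lambda>k l. xss ! k ! l) s"
  unfolding magic_squares_def matrix_of_rows_def mem_Collect_eq by (rule all_line_sums_of_nat_matrix)

text \<open>These are the sums of opposite entries on the diagonals, outer shell first.
  \<open>P + P' = s\<close> holds in a magic square because rows 0 and 3 share their noncorner
  entries with columns 1 and 2: the corners and the four central entries have equal sums, and both
  diagonals together give \<open>2 * s\<close>.\<close>

definition splits4 :: "nat \<Rightarrow> quad set" where
  "splits4 s = {(P, P', Q, Q'). P + P' = s \<and> P + Q = s \<and> P' + Q' = s}"

text \<open>The line equations split up: rows and columns are the conditions of
  \<open>fillings\<close>, the diagonals those of \<open>splits4\<close>. The inverse map reads the
  shell sums off the square; the zeros stand for the absent middle row and column.\<close>

lemma magic_squares_4_bij:
  assumes n: "CARD('n::{finite,linorder}) = 4"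
  shows "bij_betw
    (\<lambda>((P, P', Q, Q'), ((x, y, c, r), (x', y', c', r')), (w1, w2, w3, w4), (v1, v2, v3, v4)).
       matrix_of_rows [[x, w1, w2, y], [v1, x', y', v2], [v3, Q' - y', Q - x', v4], [P' - y, w3, w4, P - x]])
    (SIGMA (P, P', Q, Q') : splits4 s. fillings s P P' 0 0 Q Q' 0 0)
    (magic_squares s :: (nat, 'n) square_matrix set)"
    (is "bij_betw ?f ?W ?M")
proof -
  let ?g = "\<lambda>A :: (nat, 'n) square_matrix. let a = (\<lambda>k l. A $ idx k $ idx l) in
    ((a 0 0 + a 3 3, a 0 3 + a 3 0, a 1 1 + a 2 2, a 1 2 + a 2 1),
     ((a 0 0, a 0 3, 0 :: nat, 0 :: nat), (a 1 1, a 1 2, 0 :: nat, 0 :: nat)),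
     (a 0 1, a 0 2, a 3 1, a 3 2), (a 1 0, a 1 3, a 2 0, a 2 3))"
  have magic: "A \<in> ?M \<longleftrightarrow> line_sums 4 (\<lambda>k l. A $ idx k $ idx l) s" for A
    by (simp add: magic_squares_def all_line_sums_idx n)
  note expand = eval_nat_numeral lessThan_Suc All_less_Suc
  define F G where "F = ?f" and "G = ?g"
  have "bij_betw F ?W ?M"
  proof (rule bij_betw_byWitness[where f' = G])
    have *: "G (F (p, f)) = (p, f) \<and> F (p, f) \<in> ?M"
      if "p \<in> splits4 s" "f \<in> (case p of (P, P', Q, Q') \<Rightarrow> fillings s P P' 0 0 Q Q' 0 0)" for p f
    proof -
      obtain P P' Q Q' where p: "p = (P, P', Q, Q')" by (cases p)
      from that(2) have "f \<in> fillings s P P' 0 0 Q Q' 0 0" by (simp add: p)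
      thus ?thesis
      proof (cases rule: fillings_cases)
        case (1 x y c r x' y' c' r' w1 w2 w3 w4 v1 v2 v3 v4 xx yy cc rr xx' yy' cc' rr')
        have z: "c = 0" "cc = 0" "r = 0" "rr = 0" "c' = 0" "cc' = 0" "r' = 0" "rr' = 0"
          using 1 by auto
        note u = 1(1,2,3,6,7)
        have eqs: "(x + y) + (w1 + w2) = s" "(xx + yy) + (w3 + w4) = s"
          "(x + yy) + (v1 + v3) = s" "(xx + y) + (v2 + v4) = s"
          "(x' + y') + (v1 + v2) = s" "(xx' + yy') + (v3 + v4) = s"
          "(x' + yy') + (w1 + w3) = s" "(xx' + y') + (w2 + w4) = s"
          using that(2) fillings_add_iff[of x y 0 0 x' y' 0 0 w1 w2 w3 w4 v1 v2 v3 v4 s xx yy 0 0 xx' yy' 0 0]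
          by (simp_all add: p u z)
        have sp: "x + xx + (y + yy) = s" "x + xx + (x' + xx') = s" "y + yy + (y' + yy') = s"
          using that(1) by (auto simp: p u splits4_def)
        have "F (p, f) = matrix_of_rows [[x, w1, w2, y], [v1, x', y', v2], [v3, yy', xx', v4], [yy, w3, w4, xx]]"
          by (simp add: F_def p u)
        moreover have "matrix_of_rows [[x, w1, w2, y], [v1, x', y', v2], [v3, yy', xx', v4], [yy, w3, w4, xx]] \<in> ?M"
          unfolding matrix_of_rows_magic n line_sums_4_iff
          by (simp, insert eqs sp, intro conjI; simp only: ac_simps)
        ultimately show ?thesis by (simp add: G_def matrix_of_rows_idx n p u z)
      qed
    qed
    show "\<forall>w\<in>?W. G (F w) = w"
      using * by blast
    show "F ` ?W \<subseteq> ?M"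
      using * by blast
    have **: "G A \<in> ?W \<and> F (G A) = A" if "A \<in> ?M" for A
    proof -
      define a where "a = (\<lambda>k l. A $ idx k $ idx l)"
      have sums: "line_sums 4 a s" using that by (simp add: magic a_def)
      note eqs = sums[unfolded line_sums_4_iff]
      have "F (G A) = matrix_of_rows [[a 0 0, a 0 1, a 0 2, a 0 3], [a 1 0, a 1 1, a 1 2, a 1 3],
          [a 2 0, a 2 1, a 2 2, a 2 3], [a 3 0, a 3 1, a 3 2, a 3 3]]"
        by (simp add: F_def G_def a_def Let_def)
      also have "\<dots> = A"
        by (simp add: matrix_eq_idx n matrix_of_rows_idx expand a_def)
      finally have fg: "F (G A) = A" .
      have gA: "G A = ((a 0 0 + a 3 3, a 0 3 + a 3 0, a 1 1 + a 2 2, a 1 2 + a 2 1),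
         ((a 0 0, a 0 3, 0, 0), (a 1 1, a 1 2, 0, 0)),
         (a 0 1, a 0 2, a 3 1, a 3 2), (a 1 0, a 1 3, a 2 0, a 2 3))"
        by (simp add: F_def G_def a_def Let_def)
      have "\<dots> \<in> ?W"
      proof -
        have "(a 0 0 + a 3 3, a 0 3 + a 3 0, a 1 1 + a 2 2, a 1 2 + a 2 1) \<in> splits4 s"
          unfolding splits4_def mem_Collect_eq prod.case using eqs by (intro conjI; (simp only: ac_simps; fail |
              linarith))
        thus ?thesis
          unfolding mem_Sigma_iff prod.case
          using fillings_add_iff[of "a 0 0" "a 0 3" 0 0 "a 1 1" "a 1 2" 0 0 "a 0 1" "a 0 2" "a 3 1" "a 3 2"
            "a 1 0" "a 1 3" "a 2 0" "a 2 3" s "a 3 3" "a 3 0" 0 0 "a 2 2" "a 2 1" 0 0, unfolded add_0_right] eqs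
          by (simp only: ac_simps simp_thms)
      qed
      hence "G A \<in> ?W" by (subst gA)
      thus ?thesis using fg by (rule conjI)
    qed
    show "\<forall>A\<in>?M. F (G A) = A" "G ` ?M \<subseteq> ?W"
      using ** by blast+
  qed
  thus ?thesis by (simp only: F_def)
qed

text \<open>The four lines through the centre have the same sum \<open>P + Q\<close> off the centre,
  which is therefore \<open>s - (P + Q)\<close>. The last equation compares rows 0 and 4 with
  columns 1 and 3, which share the first block.\<close>

definition splits5 :: "nat \<Rightarrow> (quad \<times> quad) set" where
  "splits5 s = {((P, P', C, R), (Q, Q', D, T)). P + Q \<le> s \<and> P' + Q' = P + Q \<and> C + D = P + Q \<and>
     R + T = P + Q \<and> P + P' + C = Q + Q' + T}"

lemma magic_squares_5_bij:
  assumes n: "CARD('n::{finite,linorder}) = 5"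
  shows "bij_betw
    (\<lambda>(((P, P', C, R), (Q, Q', D, T)), ((x, y, c, r), (x', y', c', r')), (w1, w2, w3, w4), (v1, v2, v3, v4)).
       matrix_of_rows [[x, w1, c, w2, y], [v1, x', c', y', v2], [r, r', s - (P + Q), T - r', R - r],
         [v3, Q' - y', D - c', Q - x', v4], [P' - y, w3, C - c, w4, P - x]])
    (SIGMA ((P, P', C, R), (Q, Q', D, T)) : splits5 s. fillings s P P' C R Q Q' D T)
    (magic_squares s :: (nat, 'n) square_matrix set)"
    (is "bij_betw ?f ?W ?M")
proof -
  let ?g = "\<lambda>A :: (nat, 'n) square_matrix. let a = (\<lambda>k l. A $ idx k $ idx l) in
    (((a 0 0 + a 4 4, a 0 4 + a 4 0, a 0 2 + a 4 2, a 2 0 + a 2 4),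
      (a 1 1 + a 3 3, a 1 3 + a 3 1, a 1 2 + a 3 2, a 2 1 + a 2 3)),
     ((a 0 0, a 0 4, a 0 2, a 2 0), (a 1 1, a 1 3, a 1 2, a 2 1)),
     (a 0 1, a 0 3, a 4 1, a 4 3), (a 1 0, a 1 4, a 3 0, a 3 4))"
  have magic: "A \<in> ?M \<longleftrightarrow> line_sums 5 (\<lambda>k l. A $ idx k $ idx l) s" for A
    by (simp add: magic_squares_def all_line_sums_idx n)
  note expand = eval_nat_numeral lessThan_Suc All_less_Suc
  define F G where "F = ?f" and "G = ?g"
  have "bij_betw F ?W ?M"
  proof (rule bij_betw_byWitness[where f' = G])
    have *: "G (F (p, f)) = (p, f) \<and> F (p, f) \<in> ?M"
      if "p \<in> splits5 s" "f \<in> (\<lambda>((P, P', C, R), (Q, Q', D, T)). fillings s P P' C R Q Q' D T) p"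
      for p f
    proof -
      obtain P P' C R Q Q' D T where p: "p = ((P, P', C, R), (Q, Q', D, T))"
        by (metis surj_pair)
      from that(2) have "f \<in> fillings s P P' C R Q Q' D T" by (simp add: p)
      thus ?thesis
      proof (cases rule: fillings_cases)
        case (1 x y c r x' y' c' r' w1 w2 w3 w4 v1 v2 v3 v4 xx yy cc rr xx' yy' cc' rr')
        have eqs: "(x + y + c) + (w1 + w2) = s" "(xx + yy + cc) + (w3 + w4) = s"
          "(x + yy + r) + (v1 + v3) = s" "(xx + y + rr) + (v2 + v4) = s"
          "(x' + y' + c') + (v1 + v2) = s" "(xx' + yy' + cc') + (v3 + v4) = s"
          "(x' + yy' + r') + (w1 + w3) = s" "(xx' + y' + rr') + (w2 + w4) = s"
          using that(2) unfolding p 1 prod.case fillings_add_iff by blast+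
        define z where "z = s - (P + Q)"
        have sp: "x + xx + (x' + xx') + z = s" "y + yy + (y' + yy') + z = s"
          "c + cc + (c' + cc') + z = s" "r + rr + (r' + rr') + z = s"
          using that(1) by (auto simp: p 1 splits5_def z_def)
        have "F (p, f) = matrix_of_rows [[x, w1, c, w2, y], [v1, x', c', y', v2], [r, r', z, rr', rr],
            [v3, yy', cc', xx', v4], [yy, w3, cc, w4, xx]]"
          by (simp add: F_def p 1 z_def)
        moreover have "matrix_of_rows [[x, w1, c, w2, y], [v1, x', c', y', v2], [r, r', z, rr', rr],
            [v3, yy', cc', xx', v4], [yy, w3, cc, w4, xx]] \<in> ?M"
          unfolding matrix_of_rows_magic n line_sums_5_iff
          by (simp, insert eqs sp, intro conjI; simp only: ac_simps)
        ultimately show ?thesis by (simp add: G_def matrix_of_rows_idx n p 1)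
      qed
    qed
    show "\<forall>w\<in>?W. G (F w) = w"
      using * by blast
    show "F ` ?W \<subseteq> ?M"
      using * by blast
    have **: "G A \<in> ?W \<and> F (G A) = A" if "A \<in> ?M" for A
    proof -
      define a where "a = (\<lambda>k l. A $ idx k $ idx l)"
      have sums: "line_sums 5 a s" using that by (simp add: magic a_def)
      note eqs = sums[unfolded line_sums_5_iff]
      have diag: "a 0 0 + a 1 1 + a 2 2 + a 3 3 + a 4 4 = s" "a 0 4 + a 1 3 + a 2 2 + a 3 1 + a 4 0 = s"
        and mid: "a 2 0 + a 2 1 + a 2 2 + a 2 3 + a 2 4 = s" "a 0 2 + a 1 2 + a 2 2 + a 3 2 + a 4 2 = s"
        and rows: "a 0 0 + a 0 1 + a 0 2 + a 0 3 + a 0 4 = s" "a 4 0 + a 4 1 + a 4 2 + a 4 3 + a 4 4 = s"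
        and cols: "a 0 1 + a 1 1 + a 2 1 + a 3 1 + a 4 1 = s" "a 0 3 + a 1 3 + a 2 3 + a 3 3 + a 4 3 = s"
        using eqs by blast+
      have "s - (a 0 0 + a 4 4 + (a 1 1 + a 3 3)) = a 2 2" using diag(1) by linarith
      hence "F (G A) = matrix_of_rows [[a 0 0, a 0 1, a 0 2, a 0 3, a 0 4], [a 1 0, a 1 1, a 1 2, a 1 3, a 1 4],
          [a 2 0, a 2 1, a 2 2, a 2 3, a 2 4], [a 3 0, a 3 1, a 3 2, a 3 3, a 3 4],
          [a 4 0, a 4 1, a 4 2, a 4 3, a 4 4]]"
        by (simp add: F_def G_def a_def Let_def)
      also have "\<dots> = A"
        by (simp add: matrix_eq_idx n matrix_of_rows_idx expand a_def)
      finally have fg: "F (G A) = A" .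
      have gA: "G A = (((a 0 0 + a 4 4, a 0 4 + a 4 0, a 0 2 + a 4 2, a 2 0 + a 2 4),
      (a 1 1 + a 3 3, a 1 3 + a 3 1, a 1 2 + a 3 2, a 2 1 + a 2 3)),
     ((a 0 0, a 0 4, a 0 2, a 2 0), (a 1 1, a 1 3, a 1 2, a 2 1)),
     (a 0 1, a 0 3, a 4 1, a 4 3), (a 1 0, a 1 4, a 3 0, a 3 4))"
        by (simp add: F_def G_def a_def Let_def)
      have "\<dots> \<in> ?W"
      proof -
        have "((a 0 0 + a 4 4, a 0 4 + a 4 0, a 0 2 + a 4 2, a 2 0 + a 2 4),
          (a 1 1 + a 3 3, a 1 3 + a 3 1, a 1 2 + a 3 2, a 2 1 + a 2 3)) \<in> splits5 s"
          unfolding splits5_def mem_Collect_eq prod.case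
          using diag mid rows cols by linarith
        thus ?thesis
          unfolding mem_Sigma_iff prod.case fillings_add_iff using eqs by (intro conjI; (assumption | simp only:
              ac_simps))
      qed
      hence "G A \<in> ?W" by (subst gA)
      thus ?thesis using fg by (rule conjI)
    qed
    show "\<forall>A\<in>?M. F (G A) = A" "G ` ?M \<subseteq> ?W"
      using ** by blast+
  qed
  thus ?thesis by (simp only: F_def)
qed

section \<open>Five by five squares\<close>

text \<open>The choices of the middle entry in the first of two opposite shell lines:
  \<open>u\<close> is the sum of its two corners, \<open>W\<close> that of all four corners, and
  \<open>r\<close> the largest sum allowed in either line.\<close>

definition interval_count :: "int \<Rightarrow> int \<Rightarrow> int \<Rightarrow> int \<Rightarrow> int" where
  "interval_count W C r u = max 0 (min C (r - u) - max 0 (W + C - r - u) + 1)"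

text \<open>For given corners the top and the left middle entry are chosen independently, whence the
  product. The caps \<open>r = s - k\<close> and \<open>r' = s - l\<close> take the place of the
  thresholds.\<close>

definition shell_count :: "int \<Rightarrow> int \<Rightarrow> int \<Rightarrow> int \<Rightarrow> int \<Rightarrow> int \<Rightarrow> int" where
  "shell_count P P' C R r r' =
     (\<Sum>x\<leftarrow>[0..P]. \<Sum>y\<leftarrow>[0..P']. interval_count (P + P') C r (x + y) * interval_count (P + P') R r' (x + P' - y))"

text \<open>Integers and lists make this executable. \<open>t\<close> is the common line sum off the
  centre, \<open>R\<close> is determined by the other sums, and the tests on \<open>r\<close> and
  \<open>r'\<close> skip caps for which the first shell is empty.\<close>

definition count5 :: "int \<Rightarrow> int" where
  "count5 s = (\<Sum>t\<leftarrow>[0..s]. \<Sum>P\<leftarrow>[0..t]. \<Sum>P'\<leftarrow>[0..t]. \<Sum>C\<leftarrow>[0..t].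
     let R = 3 * t - 2 * (P + P') - C in if 0 \<le> R \<and> R \<le> t then
       (\<Sum>r\<leftarrow>[0..s]. if P + P' + C \<le> 2 * r then \<Sum>r'\<leftarrow>[0..s]. if P + P' + R \<le> 2 * r' then
          shell_count P P' C R r r' * shell_count (t - P) (t - P') (t - C) (t - R) r' r
        else 0 else 0) else 0)"

lemma card_interval_count:
  "int (card {c. c \<le> C \<and> u + c \<le> r \<and> W + C \<le> r + u + c}) = interval_count (int W) (int C) (int r) (int u)"
proof -
  have "{c. c \<le> C \<and> u + c \<le> r \<and> W + C \<le> r + u + c} =
      (if u \<le> r then {W + C - (r + u)..min C (r - u)} else {})"
    by auto
  thus ?thesis by (auto simp: interval_count_def)
qed

lemma sum_list_upto_int: "(\<Sum>x\<leftarrow>[0..int n]. f x) = (\<Sum>x\<le>n. f (int x))"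
proof -
  have "(\<Sum>x\<leftarrow>[0..int n]. f x) = (\<Sum>x\<in>int ` {0..n}. f x)"
    by (simp add: sum_list_distinct_conv_sum_set image_int_atLeastAtMost)
  thus ?thesis by (simp add: sum.reindex atMost_atLeast0 o_def)
qed

lemma card_shell:
  assumes "k \<le> s" "l \<le> s"
  shows "int (card (shell s P P' C R k l)) =
    shell_count (int P) (int P') (int C) (int R) (int (s - k)) (int (s - l))"
proof -
  let ?I = "\<lambda>C r u. {c. c \<le> C \<and> u + c \<le> r \<and> P + P' + C \<le> r + u + c}"
  have fin: "finite (?I C r u)" for C r u by (rule finite_subset[of _ "{..C}"]) auto
  have "bij_betw (\<lambda>((x, y), c, r). (x, y, c, r))
      (SIGMA (x, y) : {..P} \<times> {..P'}. ?I C (s - k) (x + y) \<times> ?I R (s - l) (x + (P' - y)))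
      (shell s P P' C R k l)"
  proof (rule bij_betw_byWitness[where f' = "\<lambda>(x, y, c, r). ((x, y), c, r)"])
    have "(x, y, c, r) \<in> shell s P P' C R k l \<longleftrightarrow> x \<le> P \<and> y \<le> P' \<and>
       c \<in> ?I C (s - k) (x + y) \<and> r \<in> ?I R (s - l) (x + (P' - y))" for x y c r
    proof (cases "x \<le> P \<and> y \<le> P' \<and> c \<le> C \<and> r \<le> R")
      case True
      then obtain xx yy cc rr where "P = x + xx" "P' = y + yy" "C = c + cc" "R = r + rr"
        by (metis le_iff_add)
      with assms show ?thesis by (auto simp: shell_def)
    qed (auto simp: shell_def)
    thus "(\<lambda>((x, y), c, r). (x, y, c, r)) `
      (SIGMA (x, y) : {..P} \<times> {..P'}. ?I C (s - k) (x + y) \<times> ?I R (s - l) (x + (P' - y)))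
      \<subseteq> shell s P P' C R k l"
      "(\<lambda>(x, y, c, r). ((x, y), c, r)) ` shell s P P' C R k l \<subseteq>
      (SIGMA (x, y) : {..P} \<times> {..P'}. ?I C (s - k) (x + y) \<times> ?I R (s - l) (x + (P' - y)))"
      by (auto simp del: mem_Collect_eq)
  qed auto
  hence c1: "card (shell s P P' C R k l) =
    card (SIGMA (x, y) : {..P} \<times> {..P'}. ?I C (s - k) (x + y) \<times> ?I R (s - l) (x + (P' - y)))"
    by (rule bij_betw_same_card[symmetric])
  have c2: "card (SIGMA (x, y) : {..P} \<times> {..P'}. ?I C (s - k) (x + y) \<times> ?I R (s - l) (x + (P' - y)))
     = (\<Sum>x\<le>P. \<Sum>y\<le>P'. card (?I C (s - k) (x + y)) * card (?I R (s - l) (x + (P' - y))))"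
    by (subst card_SigmaI)
       (simp_all only: fin card_cartesian_product sum.cartesian_product case_prod_unfold
          finite_cartesian_product finite_atMost finite_SigmaI simp_thms Ball_def)
  have c3: "int (\<Sum>x\<le>P. \<Sum>y\<le>P'. card (?I C (s - k) (x + y)) * card (?I R (s - l) (x + (P' - y)))) = (\<Sum>x\<le>P. \<Sum>y\<le>P'.
      interval_count (int P + int P') (int C) (int (s - k)) (int x + int y) *
      interval_count (int P + int P') (int R) (int (s - l)) (int x + int P' - int y))"
    by (simp only: of_nat_sum of_nat_mult card_interval_count) (auto simp: of_nat_diff intro!: sum.cong)
  show ?thesis
    by (simp only: c1 c2 c3 shell_count_def sum_list_upto_int)
qed

text \<open>Adding the sums of both diagonals and of the middle row off the centre and replacing
  \<open>Q + Q' + T\<close> by \<open>P + P' + C\<close> gives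
  \<open>3 * t = 2 * (P + P') + C + R\<close>, so \<open>R\<close> is determined by
  \<open>t\<close>, \<open>P\<close>, \<open>P'\<close> and \<open>C\<close>. The test expresses
  \<open>0 \<le> R \<le> t\<close> without subtraction.\<close>

lemma sum_splits5:
  "(\<Sum>p\<in>splits5 s. g p) = (\<Sum>t\<le>s. \<Sum>P\<le>t. \<Sum>P'\<le>t. \<Sum>C\<le>t.
     if 2 * (P + P') + C \<le> 3 * t \<and> 3 * t \<le> t + 2 * (P + P') + C
     then g ((P, P', C, 3 * t - 2 * (P + P') - C), (t - P, t - P', t - C, t - (3 * t - 2 * (P + P') - C)))
     else 0)"
proof -
  let ?A = "SIGMA t : {..s}. {..t} \<times> {..t} \<times> {..t}"
  let ?h = "\<lambda>(t, P, P', C). g ((P, P', C, 3 * t - 2 * (P + P') - C), (t - P, t - P', t - C, t - (3 * t - 2 * (P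
      + P') - C)))"
  let ?c = "\<lambda>(t, P, P', C). 2 * (P + P') + C \<le> 3 * t \<and> 3 * t \<le> t + 2 * (P + P') + C"
  let ?i = "\<lambda>(t, P, P', C). ((P, P', C, 3 * t - 2 * (P + P') - C), (t - P, t - P', t - C, t - (3 * t - 2 * (P +
      P') - C)))"
  let ?j = "\<lambda>((P, P', C, R), (Q, Q', D, T)). (P + Q, P, P', C)"
  have ij: "?i (?j p) = p \<and> ?j p \<in> {a \<in> ?A. ?c a}" if "p \<in> splits5 s" for p
  proof -
    obtain P P' C R Q Q' D T where p: "p = ((P, P', C, R), (Q, Q', D, T))"
      by (metis surj_pair)
    have eqs: "P + Q \<le> s" "P' + Q' = P + Q" "C + D = P + Q" "R + T = P + Q" "P + P' + C = Q + Q' + T"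
      using that by (auto simp: p splits5_def)
    have "3 * (P + Q) = (P + Q) + (P' + Q') + (R + T)" unfolding eqs(2,4) by simp
    also have "\<dots> = (Q + Q' + T) + P + P' + R" by simp
    also have "\<dots> = 2 * (P + P') + C + R" unfolding eqs(5)[symmetric] by simp
    finally have e: "3 * (P + Q) = 2 * (P + P') + C + R" .
    have "3 * (P + Q) - 2 * (P + P') - C = R" unfolding e by simp
    moreover have "P + Q - P' = Q'" "P + Q - C = D" "P + Q - R = T"
      "2 * (P + P') + C \<le> 3 * (P + Q)" "3 * (P + Q) \<le> P + Q + 2 * (P + P') + C"
      "P' \<le> P + Q" "C \<le> P + Q"
      using eqs e by linarith+
    ultimately show ?thesis using eqs(1) by (simp add: p)
  qed
  have ji: "?j (?i a) = a \<and> ?i a \<in> splits5 s" if "a \<in> {a \<in> ?A. ?c a}" for a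
  proof -
    obtain t P P' C where a: "a = (t, P, P', C)" by (cases a)
    define R where "R = 3 * t - 2 * (P + P') - C"
    have le: "t \<le> s" "P \<le> t" "P' \<le> t" "C \<le> t" "2 * P + 2 * P' + C + R = 3 * t" "R \<le> t"
      using that by (auto simp: a R_def)
    then obtain Q Q' D T where d: "t = P + Q" "t = P' + Q'" "t = C + D" "t = R + T"
      by (metis le_iff_add)
    hence "t - P = Q" "t - P' = Q'" "t - C = D" "t - R = T" "P + P' + C = Q + Q' + T"
      using le(5) by linarith+
    moreover have "P + Q \<le> s" "P' + Q' = P + Q" "C + D = P + Q" "R + T = P + Q" "P + Q = t"
      using d le(1) by linarith+
    ultimately show ?thesis
      unfolding a prod.case R_def[symmetric] splits5_def mem_Collect_eq by (simp only: simp_thms)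
  qed
  have "(\<Sum>p\<in>splits5 s. g p) = (\<Sum>a\<in>{a \<in> ?A. ?c a}. g (?i a))"
  proof (rule sum.reindex_bij_witness[where i = ?i and j = ?j])
    show "g (?i (?j p)) = g p" if "p \<in> splits5 s" for p using ij[OF that] by (simp only:)
  qed (fact ij[THEN conjunct1] ij[THEN conjunct2] ji[THEN conjunct1] ji[THEN conjunct2])+
  also have "\<dots> = (\<Sum>a\<in>?A. if ?c a then ?h a else 0)"
    by (subst sum.inter_filter) (auto intro!: sum.cong)
  also have "\<dots> = (\<Sum>(t, P, P', C)\<in>?A.
     if 2 * (P + P') + C \<le> 3 * t \<and> 3 * t \<le> t + 2 * (P + P') + C
     then g ((P, P', C, 3 * t - 2 * (P + P') - C), (t - P, t - P', t - C, t - (3 * t - 2 * (P + P') - C)))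
     else 0)"
    by (rule sum.cong) (simp_all only: case_prod_unfold refl)
  finally show ?thesis
    by (simp only: sum.Sigma finite_atMost finite_cartesian_product ball_simps simp_thms Ball_def sum.cartesian_product)
qed

lemma num_magic_squares_5:
  assumes n: "CARD('n::{finite,linorder}) = 5"
  shows "num_magic_squares TYPE('n) s = (\<Sum>((P, P', C, R), (Q, Q', D, T))\<in>splits5 s.
    \<Sum>k\<le>s. \<Sum>l\<le>s. card (shell s P P' C R k l) * card (shell s Q Q' D T l k))"
proof -
  have fin: "finite (fillings s P P' C R Q Q' D T)" for P P' C R Q Q' D T
    unfolding fillings_def by (auto intro!: finite_SigmaI finite_cartesian_product simp: finite_shell finite_transports)
  have "splits5 s \<subseteq> ({..s} \<times> {..s} \<times> {..s} \<times> {..s}) \<times> {..s} \<times> {..s} \<times> {..s} \<times> {..s}"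
    by (auto simp: splits5_def)
  hence fin': "finite (splits5 s)" by (rule finite_subset) simp
  have "num_magic_squares TYPE('n) s =
      card (SIGMA ((P, P', C, R), (Q, Q', D, T)) : splits5 s. fillings s P P' C R Q Q' D T)"
    unfolding num_magic_squares_def by (rule bij_betw_same_card[OF magic_squares_5_bij[OF n], symmetric])
  also have "\<dots> = (\<Sum>((P, P', C, R), (Q, Q', D, T))\<in>splits5 s. card (fillings s P P' C R Q Q' D T))"
    by (subst card_SigmaI) (auto simp: fin fin' intro!: sum.cong)
  also have "\<dots> = (\<Sum>((P, P', C, R), (Q, Q', D, T))\<in>splits5 s.
    \<Sum>k\<le>s. \<Sum>l\<le>s. card (shell s P P' C R k l) * card (shell s Q Q' D T l k))"
    by (intro sum.cong refl, clarify, rule card_fillings) (auto simp: splits5_def)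
  finally show ?thesis .
qed

text \<open>The bounds for two opposite lines add up to \<open>P + P' + C \<le> 2 * r\<close> for
  the rows and to \<open>P + P' + R \<le> 2 * r'\<close> for the columns.\<close>

lemma shell_count_eq_0:
  assumes "2 * r < P + P' + C \<or> 2 * r' < P + P' + R"
  shows "shell_count P P' C R r r' = 0"
proof -
  have "interval_count (P + P') C r u = 0 \<or> interval_count (P + P') R r' v = 0" for u v
    using assms by (auto simp: interval_count_def)
  hence "interval_count (P + P') C r u * interval_count (P + P') R r' v = 0" for u v
    by simp
  thus ?thesis by (simp only: shell_count_def sum_list_0)
qed

lemma num_magic_squares_5_eq_count5:
  assumes n: "CARD('n::{finite,linorder}) = 5"
  shows "int (num_magic_squares TYPE('n) s) = count5 (int s)"
proof -
  \<comment> \<open>Passing from thresholds \<open>k\<close> to caps \<open>s - k\<close> reverses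
    the order of summation.\<close>
  have flip: "(\<Sum>k\<le>s. f (s - k)) = (\<Sum>k\<le>s. f k)" for f :: "nat \<Rightarrow> int"
    by (rule sum.reindex_bij_witness[where i = "\<lambda>k. s - k" and j = "\<lambda>k. s - k"]) auto
  have flip2: "(\<Sum>k\<le>s. \<Sum>l\<le>s. f (s - k) (s - l)) = (\<Sum>k\<le>s. \<Sum>l\<le>s. f k l)"
    for f :: "nat \<Rightarrow> nat \<Rightarrow> int"
  proof -
    have "(\<Sum>k\<le>s. \<Sum>l\<le>s. f (s - k) (s - l)) = (\<Sum>k\<le>s. \<Sum>l\<le>s. f k (s - l))"
      by (rule flip)
    also have "\<dots> = (\<Sum>k\<le>s. \<Sum>l\<le>s. f k l)" by (intro sum.cong refl flip)
    finally show ?thesis .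
  qed
  have "int (num_magic_squares TYPE('n) s) = (\<Sum>((P, P', C, R), (Q, Q', D, T))\<in>splits5 s.
    \<Sum>k\<le>s. \<Sum>l\<le>s. shell_count P P' C R (int (s - k)) (int (s - l)) * shell_count Q Q' D T (int (s - l)) (int (s - k)))"
    unfolding num_magic_squares_5[OF n] of_nat_sum
    by (intro sum.cong refl) (auto simp: card_shell simp del: of_nat_diff intro!: sum.cong)
  also have "\<dots> = (\<Sum>((P, P', C, R), (Q, Q', D, T))\<in>splits5 s.
    \<Sum>r\<le>s. \<Sum>r'\<le>s. shell_count P P' C R (int r) (int r') * shell_count Q Q' D T (int r') (int r))"
  proof (intro sum.cong refl, clarify)
    fix P P' C R Q Q' D T :: nat
    show "(\<Sum>k\<le>s. \<Sum>l\<le>s. shell_count P P' C R (int (s - k)) (int (s - l)) *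
        shell_count Q Q' D T (int (s - l)) (int (s - k)))
      = (\<Sum>r\<le>s. \<Sum>r'\<le>s. shell_count P P' C R (int r) (int r') * shell_count Q Q' D T (int r') (int r))"
      by (rule flip2[where f = "\<lambda>r r'. shell_count P P' C R (int r) (int r') * shell_count Q Q' D T (int r') (int r)"])
  qed
  also have "\<dots> = count5 (int s)"
    unfolding sum_splits5 count5_def sum_list_upto_int Let_def
  proof (intro sum.cong refl, goal_cases)
    case (1 t P P' C)
    define R where "R = 3 * t - 2 * (P + P') - C"
    show ?case
    proof (cases "2 * (P + P') + C \<le> 3 * t \<and> 3 * t \<le> t + 2 * (P + P') + C")
      case True
      hence R: "3 * int t - 2 * (int P + int P') - int C = int R" "R \<le> t" by (auto simp: R_def)
      have "(\<Sum>r\<le>s. \<Sum>r'\<le>s. shell_count P P' C R (int r) (int r') *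
            shell_count (t - P) (t - P') (t - C) (t - R) (int r') (int r)) =
         (\<Sum>r\<le>s. if int P + int P' + int C \<le> 2 * int r then
            \<Sum>r'\<le>s. if int P + int P' + int R \<le> 2 * int r' then
              shell_count P P' C R (int r) (int r') *
              shell_count (int t - P) (int t - P') (int t - C) (int t - R) (int r') (int r) else 0
            else 0)"
        using 1 R(2) by (intro sum.cong refl) (auto simp: shell_count_eq_0 not_le intro!: sum.cong)
      moreover have "0 \<le> int R \<and> int R \<le> int t" using R(2) by simp
      ultimately show ?thesis
        unfolding R_def[symmetric] R(1) if_P[OF True] prod.case by (simp only: if_True simp_thms)
    next
      case False
      hence "\<not> (0 \<le> 3 * int t - 2 * (int P + int P') - int C \<and> 3 * int t - 2 * (int P + int P') - int C \<le> int t)"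
        by auto
      thus ?thesis unfolding if_not_P[OF False] by (simp only: if_False)
    qed
  qed
  finally show ?thesis .
qed

section \<open>Counting lattice points in a truncated box\<close>

text \<open>Depth \<open>k\<close> belongs to the corners \<open>(0, 0)\<close> and
  \<open>(p, q)\<close>, depth \<open>l\<close> to \<open>(p, 0)\<close> and
  \<open>(0, q)\<close>.\<close>

definition cut_box :: "nat \<Rightarrow> nat \<Rightarrow> nat \<Rightarrow> nat \<Rightarrow> (nat \<times> nat) set" where
  "cut_box p q k l = {(a, b). a \<le> p \<and> b \<le> q \<and> k \<le> a + b \<and> a + b + k \<le> p + q \<and>
     a + l \<le> p + b \<and> b + l \<le> q + a}"

lemma card_shell_eq_box: "card (shell (p + q) p q 0 0 k l) = card (cut_box p q k l)"
proof -
  have iff: "(x, y, c, r) \<in> shell (p + q) p q 0 0 k l \<longleftrightarrow> c = 0 \<and> r = 0 \<and> (x, y) \<in> cut_box p q k l"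
    for x y c r
  proof (cases "x \<le> p \<and> y \<le> q")
    case True
    then obtain xx yy where "p = x + xx" "q = y + yy" by (metis le_iff_add)
    thus ?thesis by (auto simp: shell_def cut_box_def)
  qed (auto simp: shell_def cut_box_def)
  have "shell (p + q) p q 0 0 k l = (\<lambda>(x, y). (x, y, 0, 0)) ` cut_box p q k l"
  proof (rule set_eqI)
    fix z :: quad
    show "z \<in> shell (p + q) p q 0 0 k l \<longleftrightarrow> z \<in> (\<lambda>(x, y). (x, y, 0, 0)) ` cut_box p q k l"
      by (cases z) (auto simp: iff)
  qed
  moreover have "inj_on (\<lambda>(x, y). (x, y, 0 :: nat, 0 :: nat)) (cut_box p q k l)"
    by (auto intro: inj_onI)
  ultimately show ?thesis by (simp only: card_image)
qed

text \<open>A quarter turn of the box exchanges its sides and its two pairs of opposite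
  corners.\<close>

lemma card_box_rotate: "card (cut_box q p l k) = card (cut_box p q k l)"
  by (rule bij_betw_same_card[where f = "\<lambda>(x, y). (y, q - x)"],
      rule bij_betw_byWitness[where f' = "\<lambda>(a, b). (q - b, a)"]) (auto simp: cut_box_def)

lemma card_box_swap: "card (cut_box q p k l) = card (cut_box p q k l)"
  by (rule bij_betw_same_card[where f = "\<lambda>(x, y). (y, x)"],
      rule bij_betw_byWitness[where f' = "\<lambda>(x, y). (y, x)"]) (auto simp: cut_box_def)

lemma card_box_commute: "card (cut_box p q l k) = card (cut_box p q k l)"
  using card_box_rotate card_box_swap by metis

text \<open>Counted column by column: for fixed \<open>a\<close> two of the cuts bound
  \<open>b\<close> from below and two from above. Truncated subtraction supplies the bounds of the
  box itself and the value 0 for empty columns.\<close>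

lemma card_box_eq_sum:
  "card (cut_box p q k l) = (\<Sum>a\<le>p. Suc q - max (k - a) (a + l - p) - max (k + a - p) (l - a))"
proof -
  have "cut_box p q k l = (SIGMA a : {..p}. {b. max (k - a) (a + l - p) \<le> b \<and> b + max (k + a - p) (l - a) \<le> q})"
    by (auto simp: cut_box_def)
  moreover have c: "card {b. m \<le> b \<and> b + v \<le> q} = Suc q - m - v" for m v
  proof -
    have "{b. m \<le> b \<and> b + v \<le> q} = (if v \<le> q then {m..q - v} else {})" by auto
    thus ?thesis by auto
  qed
  moreover have "finite {b. m \<le> b \<and> b + v \<le> q}" for m v
    by (rule finite_subset[of _ "{..q}"]) auto
  ultimately show ?thesis by (simp only: card_SigmaI c finite_atMost ball_simps simp_thms Ball_def)
qed

lemma sum_minus_from: "k \<le> Suc p \<Longrightarrow> 2 * (\<Sum>a\<le>p. int (k - a)) = int k * (int k + 1)"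
proof -
  assume "k \<le> Suc p"
  hence "(\<Sum>a\<le>p. int (k - a)) = (\<Sum>a<k. int (k - a))"
    by (intro sum.mono_neutral_right) auto
  moreover have "2 * (\<Sum>a<k. int (k - a)) = int k * (int k + 1)"
  proof (induction k)
    case (Suc k)
    have "(\<Sum>a<Suc k. int (Suc k - a)) = int (Suc k) + (\<Sum>a<k. int (k - a))"
      by (simp add: sum.lessThan_Suc_shift del: sum.lessThan_Suc)
    thus ?case using Suc by (simp add: algebra_simps)
  qed simp
  ultimately show ?thesis by simp
qed

lemma sum_minus_const: "2 * (\<Sum>a\<le>p. int (a - c)) = int (p - c) * (int (p - c) + 1)"
proof -
  have "(\<Sum>a\<le>p. int (a - c)) = (\<Sum>a\<le>p. int (p - c - a))"
    by (rule sum.reindex_bij_witness[where i = "\<lambda>a. p - a" and j = "\<lambda>a. p - a"]) auto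
  thus ?thesis by (simp only: sum_minus_from[OF le_SucI[OF diff_le_self]])
qed

text \<open>\<open>L\<close> and \<open>U\<close> are explicit forms of the lower and upper
  boundary. Equality in \<open>L a + U a \<le> Suc q\<close> is allowed: such a column is empty, and
  the exact difference still gives 0.\<close>

lemma card_box_eq_int:
  assumes "\<And>a. a \<le> p \<Longrightarrow> max (k - a) (a + l - p) = L a"
    and "\<And>a. a \<le> p \<Longrightarrow> max (k + a - p) (l - a) = U a"
    and "\<And>a. a \<le> p \<Longrightarrow> L a + U a \<le> Suc q"
  shows "int (card (cut_box p q k l)) =
    (int p + 1) * (int q + 1) - (\<Sum>a\<le>p. int (L a)) - (\<Sum>a\<le>p. int (U a))"
proof -
  have "int (card (cut_box p q k l)) = (\<Sum>a\<le>p. int q + 1 - int (L a) - int (U a))"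
    unfolding card_box_eq_sum of_nat_sum
  proof (rule sum.cong[OF refl])
    fix a assume "a \<in> {..p}"
    hence "max (k - a) (a + l - p) = L a" "max (k + a - p) (l - a) = U a" "L a + U a \<le> Suc q"
      using assms by auto
    thus "int (Suc q - max (k - a) (a + l - p) - max (k + a - p) (l - a)) = int q + 1 - int (L a) - int (U a)"
      by (simp only:)
  qed
  thus ?thesis by (simp add: sum_subtractf)
qed

text \<open>Four corners are cut off, without overlap.\<close>

lemma card_box_corners:
  assumes "p \<le> q" "k + l < p"
  shows "int (card (cut_box p q k l)) = (int p + 1) * (int q + 1) - int k * (int k + 1) - int l * (int l + 1)"
proof -
  have "int (card (cut_box p q k l)) = (int p + 1) * (int q + 1) -
    (\<Sum>a\<le>p. int ((k - a) + (a - (p - l)))) - (\<Sum>a\<le>p. int ((l - a) + (a - (p - k))))"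
  proof (rule card_box_eq_int)
    fix a assume a: "a \<le> p"
    have d: "a - (p - l) = a + l - p" "a - (p - k) = a + k - p" using assms by linarith+
    show L: "max (k - a) (a + l - p) = (k - a) + (a - (p - l))"
      unfolding d using assms a by linarith
    show U: "max (k + a - p) (l - a) = (l - a) + (a - (p - k))"
      unfolding d using assms a by linarith
    have "(k - a) + (k + a - p) \<le> Suc q" "(k - a) + (l - a) \<le> Suc q"
      "(a + l - p) + (k + a - p) \<le> Suc q" "(a + l - p) + (l - a) \<le> Suc q"
      using assms a by linarith+
    thus "(k - a) + (a - (p - l)) + ((l - a) + (a - (p - k))) \<le> Suc q"
      unfolding L[symmetric] U[symmetric] by (simp add: max_def)
  qed
  moreover have "2 * ((int p + 1) * (int q + 1) -
      (\<Sum>a\<le>p. int ((k - a) + (a - (p - l)))) - (\<Sum>a\<le>p. int ((l - a) + (a - (p - k)))))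
    = 2 * ((int p + 1) * (int q + 1) - int k * (int k + 1) - int l * (int l + 1))"
    using assms sum_minus_from[of k p] sum_minus_from[of l p] sum_minus_const[where p = p and c = "p - l"]
      sum_minus_const[where p = p and c = "p - k"]
    unfolding of_nat_add sum.distrib by simp
  ultimately show ?thesis by simp
qed

text \<open>The two cuts of depth \<open>k\<close> run across the full width and imply those of
  depth \<open>l\<close>. What remains is a slanted strip whose columns all have the same
  length.\<close>

lemma card_box_strip:
  assumes "l + p \<le> k" "2 * k \<le> p + q"
  shows "int (card (cut_box p q k l)) = (int p + 1) * (int (p + q) + 1 - 2 * int k)"
proof -
  have "int (card (cut_box p q k l)) = (int p + 1) * (int q + 1) -
     (\<Sum>a\<le>p. int (k - a)) - (\<Sum>a\<le>p. int (k + a - p))"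
  proof (rule card_box_eq_int)
    fix a assume a: "a \<le> p"
    show "max (k - a) (a + l - p) = k - a" "max (k + a - p) (l - a) = k + a - p"
      "k - a + (k + a - p) \<le> Suc q"
      using assms a by linarith+
  qed
  also have "\<dots> = (\<Sum>a\<le>p. int q + 1 - int (k - a) - int (k + a - p))"
    by (simp add: sum_subtractf)
  also have "\<dots> = (\<Sum>a\<le>p. int (p + q) + 1 - 2 * int k)"
  proof (rule sum.cong[OF refl])
    fix a assume "a \<in> {..p}"
    thus "int q + 1 - int (k - a) - int (k + a - p) = int (p + q) + 1 - 2 * int k"
      using assms by auto
  qed
  finally show ?thesis by simp
qed

text \<open>The parameters arise from \<open>k + l = 2 * z + p\<close> and
  \<open>k - l = x - x'\<close>. Neighbouring cut lines meet at \<open>a = x\<close> below and at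
  \<open>a = x'\<close> above, so each boundary is \<open>z\<close> plus the distance from there,
  written as \<open>(x - a) + (a - x)\<close> in natural numbers.\<close>

lemma card_box_middle_even:
  "int (card (cut_box (x + x') (2 * z + 2 * y + x + x' + c) (z + x) (z + x')))
    = (int (x + x') + 1) * (2 * int y + 1 + int c) + 2 * int x * int x'"
proof -
  let ?p = "x + x'" and ?q = "2 * z + 2 * y + x + x' + c"
  have "int (card (cut_box ?p ?q (z + x) (z + x'))) = (int ?p + 1) * (int ?q + 1) -
    (\<Sum>a\<le>?p. int (z + ((x - a) + (a - x)))) - (\<Sum>a\<le>?p. int (z + ((x' - a) + (a - x'))))"
  proof (rule card_box_eq_int)
    fix a assume a: "a \<le> ?p"
    show "max (z + x - a) (a + (z + x') - ?p) = z + ((x - a) + (a - x))"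
      "max (z + x + a - ?p) (z + x' - a) = z + ((x' - a) + (a - x'))"
      by linarith+
    have "(x - a) + (a - x) + ((x' - a) + (a - x')) \<le> ?p" using a by linarith
    thus "z + ((x - a) + (a - x)) + (z + ((x' - a) + (a - x'))) \<le> Suc ?q" by linarith
  qed
  moreover have "2 * ((int ?p + 1) * (int ?q + 1) -
      (\<Sum>a\<le>?p. int (z + ((x - a) + (a - x)))) - (\<Sum>a\<le>?p. int (z + ((x' - a) + (a - x')))))
    = 2 * ((int ?p + 1) * (2 * int y + 1 + int c) + 2 * int x * int x')"
    using sum_minus_from[of x ?p] sum_minus_from[of x' ?p] sum_minus_const[where p = "?p" and c = x]
        sum_minus_const[where p = "?p" and c = x']
    unfolding of_nat_add sum.distrib by (simp add: algebra_simps)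
  ultimately show ?thesis by simp
qed

text \<open>For odd \<open>k + l + p\<close> the cut lines meet halfway between \<open>x\<close> and
  \<open>Suc x\<close> below and between \<open>x'\<close> and \<open>Suc x'\<close> above, so two
  adjacent columns attain the least depth \<open>z\<close>.\<close>

lemma card_box_middle_odd:
  assumes "q + c = 2 * z + 2 * y + x + x' + 1"  "c \<le> 1"
  shows "int (card (cut_box (x + x' + 1) q (z + x) (z + x')))
    = (int (x + x') + 2) * (2 * int y + 1 - int c) + 2 * (int (x + x') + 1) + 2 * int x * int x'"
proof -
  let ?p = "x + x' + 1"
  have "int (card (cut_box ?p q (z + x) (z + x'))) = (int ?p + 1) * (int q + 1) -
    (\<Sum>a\<le>?p. int (z + ((x - a) + (a - Suc x)))) - (\<Sum>a\<le>?p. int (z + ((x' - a) + (a - Suc x'))))"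
  proof (rule card_box_eq_int)
    fix a assume a: "a \<le> ?p"
    show "max (z + x - a) (a + (z + x') - ?p) = z + ((x - a) + (a - Suc x))"
      "max (z + x + a - ?p) (z + x' - a) = z + ((x' - a) + (a - Suc x'))"
      by linarith+
    have "(x - a) + (a - Suc x) + ((x' - a) + (a - Suc x')) \<le> x + x'" using a by linarith
    thus "z + ((x - a) + (a - Suc x)) + (z + ((x' - a) + (a - Suc x'))) \<le> Suc q" using assms by linarith
  qed
  moreover have q: "int q = 2 * int z + 2 * int y + int x + int x' + 1 - int c" using assms by linarith
  have "2 * ((int ?p + 1) * (int q + 1) -
      (\<Sum>a\<le>?p. int (z + ((x - a) + (a - Suc x)))) - (\<Sum>a\<le>?p. int (z + ((x' - a) + (a - Suc x')))))
    = 2 * ((int (x + x') + 2) * (2 * int y + 1 - int c) + 2 * (int (x + x') + 1) + 2 * int x * int x')"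
    using sum_minus_from[of x ?p] sum_minus_from[of x' ?p] sum_minus_const[where p = "?p" and c = "Suc x"]
        sum_minus_const[where p = "?p" and c = "Suc x'"]
    unfolding of_nat_add sum.distrib by (simp add: q algebra_simps)
  ultimately show ?thesis by simp
qed

lemma sum_alternating: "(\<Sum>u\<le>K. (- 1) ^ u) = (if even K then 1 else 0 :: int)"
  by (induction K) auto

text \<open>Twice the indicator of evenness is 1 plus a sign, and the sum of the signs factors into
  two alternating sums, which vanish for odd \<open>K\<close> or \<open>L\<close>.\<close>

lemma card_parity:
  "2 * int (card {(u, v). u \<le> K \<and> v \<le> L \<and> even (u + v + e)})
     = (int K + 1) * (int L + 1) + (if even K \<and> even L then (- 1) ^ e else 0)"
proof -
  have "{(u, v). u \<le> K \<and> v \<le> L \<and> even (u + v + e)} = {x \<in> {..K} \<times> {..L}. even (fst x + snd x + e)}"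
    by auto
  hence "int (card {(u, v). u \<le> K \<and> v \<le> L \<and> even (u + v + e)})
      = int (\<Sum>x\<in>{..K} \<times> {..L}. if even (fst x + snd x + e) then 1 else 0)"
    by (simp only: card_if finite_cartesian_product finite_atMost)
  also have "\<dots> = (\<Sum>x\<in>{..K} \<times> {..L}. if even (fst x + snd x + e) then 1 else 0)"
    by (simp only: of_nat_sum if_distrib[of int] of_nat_1 of_nat_0)
  also have "2 * \<dots> = (\<Sum>x\<in>{..K} \<times> {..L}. 1 + (- 1) ^ e * ((- 1) ^ fst x * (- 1) ^ snd x))"
    unfolding sum_distrib_left by (rule sum.cong) (auto simp: minus_one_power_iff)
  also have "\<dots> = (int K + 1) * (int L + 1) + (- 1) ^ e * ((\<Sum>u\<le>K. (- 1) ^ u) * (\<Sum>v\<le>L. (- 1) ^ v))"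
    unfolding sum_product sum.cartesian_product case_prod_unfold
    by (simp add: sum.distrib card_cartesian_product algebra_simps flip: sum_distrib_left)
  finally show ?thesis by (simp add: sum_alternating)
qed

text \<open>Here the bounds on \<open>a\<close> and \<open>b\<close> are implied by those on \<open>a + b\<close> and \<open>a - b\<close>.\<close>

lemma card_box_rotated:
  assumes "p \<le> q" "q \<le> k + l" "2 * k \<le> p + q" "2 * l \<le> p + q"
  shows "card (cut_box p q k l) = card {(u, v). u \<le> p + q - 2 * k \<and> v \<le> p + q - 2 * l \<and> even (u + v + (k + l + q))}"
proof (rule bij_betw_same_card)
  show "bij_betw (\<lambda>(a, b). (a + b - k, a + q - b - l)) (cut_box p q k l)
    {(u, v). u \<le> p + q - 2 * k \<and> v \<le> p + q - 2 * l \<and> even (u + v + (k + l + q))}"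
  \<comment> \<open>The inverse solves \<open>u + v = 2 * a + q - k - l\<close> for
    \<open>a\<close>; the subtraction \<open>k + l - q\<close> is exact because
    \<open>q \<le> k + l\<close>.\<close>
  proof (rule bij_betw_byWitness[where
      f' = "\<lambda>(u, v). ((u + v + (k + l - q)) div 2, u + k - (u + v + (k + l - q)) div 2)"], goal_cases)
    case 1
    have h: "((a + b - k) + (a + q - b - l) + (k + l - q)) div 2 = a" "a + b - k + k - a = b"
      if "(a, b) \<in> cut_box p q k l" for a b
    proof -
      have "(a + b - k) + (a + q - b - l) + (k + l - q) = 2 * a" using that assms by (auto simp: cut_box_def)
      thus "((a + b - k) + (a + q - b - l) + (k + l - q)) div 2 = a" by simp
      show "a + b - k + k - a = b" using that by (auto simp: cut_box_def)
    qed
    show ?case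
    proof (rule ballI, goal_cases)
      case (1 x)
      obtain a b where x: "x = (a, b)" by (cases x)
      show ?case unfolding x prod.case using h[of a b] 1 by (simp only: x)
    qed
  next
    case 2
    {
      fix u v assume uv: "u \<le> p + q - 2 * k" "v \<le> p + q - 2 * l" "even (u + v + (k + l + q))"
      define a where "a = (u + v + (k + l - q)) div 2"
      have "even (u + v + (k + l - q))" using uv(3) assms(2) by auto
      hence "2 * a = u + v + (k + l - q)" unfolding a_def by simp
      hence "a + (u + k - a) - k = u" "a + q - (u + k - a) - l = v"
        using uv assms by linarith+
    }
    thus ?case by auto
  next
    case 3
    have "even ((a + b - k) + (a + q - b - l) + (k + l + q))" if "(a, b) \<in> cut_box p q k l" for a b
    proof -
      have "(a + b - k) + (a + q - b - l) + (k + l + q) = 2 * (a + q)" using that assms by (auto simp: cut_box_def)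
      thus ?thesis by simp
    qed
    thus ?case using assms by (auto simp: cut_box_def)
  next
    case 4
    {
      fix u v assume uv: "u \<le> p + q - 2 * k" "v \<le> p + q - 2 * l" "even (u + v + (k + l + q))"
      define a where "a = (u + v + (k + l - q)) div 2"
      have "even (u + v + (k + l - q))" using uv(3) assms(2) by auto
      hence "2 * a = u + v + (k + l - q)" unfolding a_def by simp
      hence "(a, u + k - a) \<in> cut_box p q k l"
        using uv assms unfolding cut_box_def mem_Collect_eq prod.case by linarith
    }
    thus ?case by auto
  qed
qed

section \<open>Summation of the section counts\<close>

text \<open>The factor \<open>d\<close> clears denominators, so that each closed form below reduces
  to a polynomial identity over the integers between successive values.\<close>

lemma int_sum_closed_form:
  fixes F f :: "nat \<Rightarrow> int"
  assumes "F 0 = 0" "\<And>j. F (Suc j) = F j + d * f j"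
  shows "d * (\<Sum>i<j. f i) = F j"
  by (induction j) (simp_all add: assms distrib_left)

lemma sum_square_shifted:
  fixes A :: int
  shows "15 * (\<Sum>i<j. (A - int i * (int i + 1))^2)
    = 3 * int j^5 - 10 * A * int j^3 + 15 * A^2 * int j - 5 * int j^3 + 10 * A * int j + 2 * int j"
  by (rule int_sum_closed_form) (simp_all, algebra)

text \<open>The summand is the right-hand side of \<open>sum_square_shifted\<close> for the
  threshold \<open>k = i\<close>. The bound \<open>j\<close> is kept apart from \<open>p\<close> so
  that the induction leaves the summand fixed; later \<open>j = p\<close>.\<close>

lemma sum_corners_outer:
  fixes p q :: int
  shows "6 * (\<Sum>i<j. 3 * (p - int i)^5 - 10 * ((p + 1) * (q + 1) - int i * (int i + 1)) * (p - int i)^3 + 15 * ((p +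
    1) * (q + 1) - int i * (int i + 1))^2 * (p - int i) - 5 * (p - int i)^3 + 10 * ((p + 1) * (q +
    1) - int i * (int i + 1)) * (p - int i) + 2 * (p - int i))
    = 90 * int j * p^3 * q^2 - 60 * int j * p^4 * q + 18 * int j * p^5 - 45 * int j^2 * p^2 * q^2 + 90
    * int j^2 * p^3 * q - 45 * int j^2 * p^4 - 120 * int j^3 * p^2 * q + 80 * int j^3 * p^3 + 60 *
    int j^4 * p * q - 90 * int j^4 * p^2 + 72 * int j^5 * p - 28 * int j^6 + 225 * int j * p^2 * q^2
    + 30 * int j * p^3 * q - 15 * int j * p^4 - 90 * int j^2 * p * q^2 + 90 * int j^2 * p^2 * q -
    180 * int j^3 * p * q - 30 * int j^4 * p + 60 * int j^4 * q + 36 * int j^5 + 180 * int j * p *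
    q^2 + 450 * int j * p^2 * q - 80 * int j * p^3 - 150 * int j^2 * p * q + 180 * int j^2 * p^2 -
    45 * int j^2 * q^2 - 260 * int j^3 * p - 60 * int j^3 * q + 110 * int j^4 + 510 * int j * p * q
    + 150 * int j * p^2 + 45 * int j * q^2 + 30 * int j^2 * p - 150 * int j^2 * q - 120 * int j^3 +
    350 * int j * p + 150 * int j * q - 127 * int j^2 + 129 * int j"
  by (rule int_sum_closed_form) (simp_all, algebra)

lemma sum_square_linear:
  fixes u v :: int
  shows "6 * (\<Sum>i<j. (u + v * int i)^2)
    = 2 * int j^3 * v^2 + 6 * int j^2 * u * v - 3 * int j^2 * v^2 - 6 * int j * u * v + 6 * int j *
    u^2 + int j * v^2"
  by (rule int_sum_closed_form) (simp_all, algebra)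

lemma sum_middle_outer:
  fixes B r v m :: int
  shows "5 * (\<Sum>i<j. 2 * m^3 * v^2 + 6 * m^2 * (B + 2 * int i * (r - int i)) * v - 3 * m^2 * v^2 - 6 * m * (B + 2 *
    int i * (r - int i)) * v + 6 * m * (B + 2 * int i * (r - int i))^2 + m * v^2)
    = 10 * int j * m^3 * v^2 + 30 * int j^2 * m^2 * r * v + 40 * int j^3 * m * r^2 - 20 * int j^3 *
    m^2 * v - 60 * int j^4 * m * r + 24 * int j^5 * m + 30 * B * int j * m^2 * v + 60 * B * int j^2
    * m * r - 40 * B * int j^3 * m - 30 * int j * m^2 * r * v - 15 * int j * m^2 * v^2 - 30 * int
    j^2 * m * r * v - 60 * int j^2 * m * r^2 + 30 * int j^2 * m^2 * v + 120 * int j^3 * m * r + 20 *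
    int j^3 * m * v - 60 * int j^4 * m - 60 * B * int j * m * r - 30 * B * int j * m * v + 60 * B *
    int j^2 * m + 30 * B^2 * int j * m + 30 * int j * m * r * v + 20 * int j * m * r^2 + 5 * int j *
    m * v^2 - 10 * int j * m^2 * v - 60 * int j^2 * m * r - 30 * int j^2 * m * v + 40 * int j^3 * m
    - 20 * B * int j * m + 10 * int j * m * v - 4 * int j * m"
  by (rule int_sum_closed_form) (simp_all, algebra)

text \<open>The count in a strip depends only on the larger threshold, so the inner sum has
  \<open>n - i\<close> equal terms.\<close>

lemma sum_strip:
  fixes n c p :: int
  shows "6 * (\<Sum>i<j. (n - int i) * ((p + 1) * (2 * int i + c + 1))^2)
    = 12 * c * int j^2 * n * p^2 - 8 * c * int j^3 * p^2 + 6 * c^2 * int j * n * p^2 - 3 * c^2 * int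
    j^2 * p^2 + 8 * int j^3 * n * p^2 - 6 * int j^4 * p^2 + 24 * c * int j^2 * n * p + 6 * c * int
    j^2 * p^2 - 16 * c * int j^3 * p + 12 * c^2 * int j * n * p + 3 * c^2 * int j * p^2 - 6 * c^2 *
    int j^2 * p + 16 * int j^3 * n * p + 4 * int j^3 * p^2 - 12 * int j^4 * p + 2 * c * int j * p^2
    + 12 * c * int j^2 * n + 12 * c * int j^2 * p - 8 * c * int j^3 + 6 * c^2 * int j * n + 6 * c^2
    * int j * p - 3 * c^2 * int j^2 - 2 * int j * n * p^2 + 3 * int j^2 * p^2 + 8 * int j^3 * n + 8
    * int j^3 * p - 6 * int j^4 + 4 * c * int j * p + 6 * c * int j^2 + 3 * c^2 * int j - 4 * int j
    * n * p - int j * p^2 + 6 * int j^2 * p + 4 * int j^3 + 2 * c * int j - 2 * int j * n - 2 * int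
    j * p + 3 * int j^2 - int j"
  by (rule int_sum_closed_form) (simp_all, algebra)

lemma sum_rotated_odd_inner:
  fixes u :: int
  shows "3 * (\<Sum>i<j. (2 * (u * (int i + 1)))^2)
    = 4 * int j^3 * u^2 + 6 * int j^2 * u^2 + 2 * int j * u^2"
  by (rule int_sum_closed_form) (simp_all, algebra)

lemma sum_rotated_odd_outer:
  fixes p :: int
  shows "30 * (\<Sum>i<j. 4 * (p - 1 - int i)^3 * (int i + 1)^2 + 6 * (p - 1 - int i)^2 * (int i + 1)^2 + 2 * (p - 1 - int
    i) * (int i + 1)^2)
    = 40 * int j^3 * p^3 - 90 * int j^4 * p^2 + 72 * int j^5 * p - 20 * int j^6 + 60 * int j^2 * p^3 -
    120 * int j^3 * p^2 + 90 * int j^4 * p - 24 * int j^5 + 20 * int j * p^3 - 40 * int j^3 * p + 25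
    * int j^4 + 30 * int j * p^2 - 60 * int j^2 * p + 30 * int j^3 - 2 * int j * p - 5 * int j^2 - 6
    * int j"
  by (rule int_sum_closed_form) (simp_all, algebra)

lemma sum_rotated_even_inner:
  fixes u :: int
  shows "3 * (\<Sum>i<j. (u * (2 * int i + 1))^2 + 1)
    = 4 * int j^3 * u^2 - int j * u^2 + 3 * int j"
  by (rule int_sum_closed_form) (simp_all, algebra)

lemma sum_rotated_even_outer:
  fixes p :: int
  shows "15 * (\<Sum>i<j. 4 * (p - int i)^3 * (2 * int i + 1)^2 - (p - int i) * (2 * int i + 1)^2 + 3 * (p - int i))
    = 80 * int j^3 * p^3 - 180 * int j^4 * p^2 + 144 * int j^5 * p - 40 * int j^6 + 120 * int j^3 *
    p^2 - 180 * int j^4 * p + 72 * int j^5 - 20 * int j * p^3 + 90 * int j^2 * p^2 - 80 * int j^3 *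
    p + 20 * int j^4 - 30 * int j * p^2 + 90 * int j^2 * p - 60 * int j^3 + 56 * int j * p - 25 *
    int j^2 + 33 * int j"
  by (rule int_sum_closed_form) (simp_all, algebra)

lemma sum_rotated_even_alternating:
  fixes p :: int
  shows "6 * (\<Sum>i<j. (2 * int i + 1) * (p - int i))
    = 6 * int j^2 * p - 4 * int j^3 + 3 * int j^2 + int j"
  by (rule int_sum_closed_form) (simp_all, algebra)

text \<open>The summand is 15 times the sum over all thresholds for \<open>p = i\<close> and magic
  sum \<open>2 * h\<close>, as found in \<open>section_sum_even\<close>; the next lemma has 30 and
  \<open>2 * h + 1\<close> instead.\<close>

lemma sum_sections_even:
  fixes h :: int
  shows "6 * (\<Sum>i<j. 4 * h * int i^5 - 10 * h^2 * int i^4 + 10 * h^4 * int i^2 - 40 * h^2 * int i^3 + 40 * h^3 * int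
    i^2 + 20 * h^4 * int i + 4 * int i^5 - 50 * h * int i^3 + 15 * h^2 * int i^2 + 80 * h^3 * int i
    + 10 * h^4 + 10 * int i^4 - 40 * h * int i^2 + 110 * h^2 * int i + 40 * h^3 - 10 * int i^3 + 56
    * h * int i + 65 * h^2 - 25 * int i^2 + 50 * h + 6 * int i + 15)
    = 4 * h * int j^6 - 12 * h^2 * int j^5 + 20 * h^4 * int j^3 - 12 * h * int j^5 - 30 * h^2 * int
    j^4 + 80 * h^3 * int j^3 + 30 * h^4 * int j^2 + 4 * int j^6 - 65 * h * int j^4 + 130 * h^2 * int
    j^3 + 120 * h^3 * int j^2 + 10 * h^4 * int j + 70 * h * int j^3 + 225 * h^2 * int j^2 + 40 * h^3
    * int j - 35 * int j^4 + 211 * h * int j^2 + 77 * h^2 * int j + 92 * h * int j + 76 * int j^2 +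
    45 * int j"
  by (rule int_sum_closed_form) (simp_all, algebra)

lemma sum_sections_odd:
  fixes h :: int
  shows "3 * (\<Sum>i<j. 8 * h * int i^5 - 20 * h^2 * int i^4 + 20 * h^4 * int i^2 - 20 * h * int i^4 - 80 * h^2 * int
    i^3 + 120 * h^3 * int i^2 + 40 * h^4 * int i + 12 * int i^5 - 180 * h * int i^3 + 180 * h^2 *
    int i^2 + 240 * h^3 * int i + 20 * h^4 + 15 * int i^4 + 20 * h * int i^2 + 520 * h^2 * int i +
    120 * h^3 - 90 * int i^3 + 472 * h * int i + 280 * h^2 - 75 * int i^2 + 300 * h + 138 * int i +
    120)
    = 4 * h * int j^6 - 12 * h^2 * int j^5 + 20 * h^4 * int j^3 - 24 * h * int j^5 - 30 * h^2 * int
    j^4 + 120 * h^3 * int j^3 + 30 * h^4 * int j^2 + 6 * int j^6 - 95 * h * int j^4 + 280 * h^2 *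
    int j^3 + 180 * h^3 * int j^2 + 10 * h^4 * int j - 9 * int j^5 + 270 * h * int j^3 + 450 * h^2 *
    int j^2 + 60 * h^3 * int j - 75 * int j^4 + 541 * h * int j^2 + 152 * h^2 * int j + 75 * int j^3
    + 204 * h * int j + 249 * int j^2 + 114 * int j"
  by (rule int_sum_closed_form) (simp_all, algebra)

lemma double_sum_corners:
  "90 * (\<Sum>k<p. \<Sum>l<p - k. ((int p + 1) * (q + 1) - int k * (int k + 1) - int l * (int l + 1))^2)
    = 45 * int p^4 * q^2 - 30 * int p^5 * q + 7 * int p^6 + 135 * int p^3 * q^2 - 9 * int p^5 + 135 *
    int p^2 * q^2 + 240 * int p^3 * q - 50 * int p^4 + 45 * int p * q^2 + 360 * int p^2 * q + 60 *
    int p^3 + 150 * int p * q + 223 * int p^2 + 129 * int p"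
proof -
  let ?P = "\<lambda>A m :: int. 3 * m^5 - 10 * A * m^3 + 15 * A^2 * m - 5 * m^3 + 10 * A * m + 2 * m"
  let ?A = "\<lambda>k. (int p + 1) * (q + 1) - int k * (int k + 1)"
  have "90 * (\<Sum>k<p. \<Sum>l<p - k. (?A k - int l * (int l + 1))^2)
      = 6 * (\<Sum>k<p. 15 * (\<Sum>l<p - k. (?A k - int l * (int l + 1))^2))"
    by (simp add: sum_distrib_left)
  also have "(\<Sum>k<p. 15 * (\<Sum>l<p - k. (?A k - int l * (int l + 1))^2)) = (\<Sum>k<p. ?P (?A k) (int p - int k))"
    by (rule sum.cong[OF refl]) (simp only: sum_square_shifted of_nat_diff lessThan_iff less_imp_le)
  also have "6 * \<dots> = 45 * int p^4 * q^2 - 30 * int p^5 * q + 7 * int p^6 + 135 * int p^3 * q^2 - 9 * int p^5 + 135 *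
    int p^2 * q^2 + 240 * int p^3 * q - 50 * int p^4 + 45 * int p * q^2 + 360 * int p^2 * q + 60 *
    int p^3 + 150 * int p * q + 223 * int p^2 + 129 * int p"
    by (subst sum_corners_outer) algebra
  finally show ?thesis .
qed

lemma double_sum_middle:
  "30 * (\<Sum>x<j. \<Sum>y<m. ((B + 2 * int x * (r - int x)) + v * int y)^2)
    = 10 * int j * int m^3 * v^2 + 30 * int j^2 * int m^2 * r * v + 40 * int j^3 * int m * r^2 - 20 *
    int j^3 * int m^2 * v - 60 * int j^4 * int m * r + 24 * int j^5 * int m + 30 * B * int j * int
    m^2 * v + 60 * B * int j^2 * int m * r - 40 * B * int j^3 * int m - 30 * int j * int m^2 * r * v
    - 15 * int j * int m^2 * v^2 - 30 * int j^2 * int m * r * v - 60 * int j^2 * int m * r^2 + 30 *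
    int j^2 * int m^2 * v + 120 * int j^3 * int m * r + 20 * int j^3 * int m * v - 60 * int j^4 *
    int m - 60 * B * int j * int m * r - 30 * B * int j * int m * v + 60 * B * int j^2 * int m + 30
    * B^2 * int j * int m + 30 * int j * int m * r * v + 20 * int j * int m * r^2 + 5 * int j * int
    m * v^2 - 10 * int j * int m^2 * v - 60 * int j^2 * int m * r - 30 * int j^2 * int m * v + 40 *
    int j^3 * int m - 20 * B * int j * int m + 10 * int j * int m * v - 4 * int j * int m"
proof -
  have "30 * (\<Sum>x<j. \<Sum>y<m. ((B + 2 * int x * (r - int x)) + v * int y)^2)
      = 5 * (\<Sum>x<j. 6 * (\<Sum>y<m. ((B + 2 * int x * (r - int x)) + v * int y)^2))"
    by (simp add: sum_distrib_left)
  also have "\<dots> = 10 * int j * int m^3 * v^2 + 30 * int j^2 * int m^2 * r * v + 40 * int j^3 * int m * r^2 - 20 *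
    int j^3 * int m^2 * v - 60 * int j^4 * int m * r + 24 * int j^5 * int m + 30 * B * int j * int
    m^2 * v + 60 * B * int j^2 * int m * r - 40 * B * int j^3 * int m - 30 * int j * int m^2 * r * v
    - 15 * int j * int m^2 * v^2 - 30 * int j^2 * int m * r * v - 60 * int j^2 * int m * r^2 + 30 *
    int j^2 * int m^2 * v + 120 * int j^3 * int m * r + 20 * int j^3 * int m * v - 60 * int j^4 *
    int m - 60 * B * int j * int m * r - 30 * B * int j * int m * v + 60 * B * int j^2 * int m + 30
    * B^2 * int j * int m + 30 * int j * int m * r * v + 20 * int j * int m * r^2 + 5 * int j * int
    m * v^2 - 10 * int j * int m^2 * v - 60 * int j^2 * int m * r - 30 * int j^2 * int m * v + 40 *
    int j^3 * int m - 20 * B * int j * int m + 10 * int j * int m * v - 4 * int j * int m"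
    unfolding sum_square_linear
    by (subst sum_middle_outer; (rule refl | algebra))
  finally show ?thesis .
qed

lemma double_sum_rotated_odd:
  "90 * (\<Sum>i<p. \<Sum>j<p - 1 - i. (2 * ((int i + 1) * (int j + 1)))^2) = 2 * int p^6 + 6 * int p^5 + 5 * int p^4 - 7
      * int p^2 - 6 * int p"
proof -
  let ?P = "\<lambda>u m :: int. 4 * m^3 * u^2 + 6 * m^2 * u^2 + 2 * m * u^2"
  have "90 * (\<Sum>i<p. \<Sum>j<p - 1 - i. (2 * ((int i + 1) * (int j + 1)))^2)
      = 30 * (\<Sum>i<p. 3 * (\<Sum>j<p - 1 - i. (2 * ((int i + 1) * (int j + 1)))^2))"
    by (simp add: sum_distrib_left)
  also have "(\<Sum>i<p. 3 * (\<Sum>j<p - 1 - i. (2 * ((int i + 1) * (int j + 1)))^2)) = (\<Sum>i<p. ?P (int i + 1) (int p - 1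
      - int i))"
  proof (rule sum.cong[OF refl])
    fix i assume "i \<in> {..<p}"
    hence "int (p - 1 - i) = int p - 1 - int i" by auto
    thus "3 * (\<Sum>j<p - 1 - i. (2 * ((int i + 1) * (int j + 1)))^2) = ?P (int i + 1) (int p - 1 - int i)"
      by (simp only: sum_rotated_odd_inner)
  qed
  also have "30 * \<dots> = 2 * int p^6 + 6 * int p^5 + 5 * int p^4 - 7 * int p^2 - 6 * int p"
    by (subst sum_rotated_odd_outer) algebra
  finally show ?thesis .
qed

lemma sum_alternating_odd: "(\<Sum>j<m. (- 1) ^ j * (2 * int j + 1)) = - ((- 1) ^ m * int m)"
  by (induction m) (simp_all add: algebra_simps)

text \<open>The summand is four times the square of a number whose double is
  \<open>(2 * i + 1) * (2 * j + 1)\<close> plus the sign from \<open>card_parity\<close>. The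
  alternating part collapses in \<open>j\<close> and contributes only a cubic polynomial.\<close>

lemma double_sum_rotated_even:
  "90 * (\<Sum>i<p. \<Sum>j<p - i. ((2 * int i + 1) * (2 * int j + 1))^2 + 1 +
      2 * ((- 1) ^ (i + j + p) * ((2 * int i + 1) * (2 * int j + 1)))) = 4 * (2 * int p^6 + 6 * int p^5 + 5 *
          int p^4 - 15 * int p^3 - 7 * int p^2 + 9 * int p)"
proof -
  let ?P = "\<lambda>u m :: int. 4 * m^3 * u^2 - m * u^2 + 3 * m"
  have "(\<Sum>i<p. 3 * (\<Sum>j<p - i. ((2 * int i + 1) * (2 * int j + 1))^2 + 1)) = (\<Sum>i<p. ?P (2 * int i + 1) (int p - int i))"
    by (rule sum.cong[OF refl]) (simp only: sum_rotated_even_inner of_nat_diff lessThan_iff less_imp_le)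
  hence sq: "3 * (\<Sum>i<p. \<Sum>j<p - i. ((2 * int i + 1) * (2 * int j + 1))^2 + 1)
      = (\<Sum>i<p. ?P (2 * int i + 1) (int p - int i))"
    by (simp only: sum_distrib_left)
  have "(\<Sum>j<p - i. (- 1) ^ (i + j + p) * ((2 * int i + 1) * (2 * int j + 1))) = - ((2 * int i + 1) * (int p - int i))"
    if i: "i < p" for i
  proof -
    obtain d where p: "p = i + d" using le_Suc_ex[OF less_imp_le[OF i]] by blast
    have "(\<Sum>j<p - i. (- 1) ^ (i + j + p) * ((2 * int i + 1) * (2 * int j + 1)))
        = (\<Sum>j<d. ((- 1) ^ d * (2 * int i + 1)) * ((- 1) ^ j * (2 * int j + 1)))"
      unfolding p by (intro sum.cong) (auto simp: minus_one_power_iff)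
    also have "\<dots> = - ((2 * int i + 1) * int d)"
      unfolding sum_distrib_left[symmetric] sum_alternating_odd
      by (auto simp: minus_one_power_iff)
    finally show ?thesis by (simp add: p)
  qed
  hence "(\<Sum>i<p. \<Sum>j<p - i. (- 1) ^ (i + j + p) * ((2 * int i + 1) * (2 * int j + 1)))
      = - (\<Sum>i<p. (2 * int i + 1) * (int p - int i))"
    by (simp add: sum_negf)
  hence alt: "6 * (\<Sum>i<p. \<Sum>j<p - i. (- 1) ^ (i + j + p) * ((2 * int i + 1) * (2 * int j + 1))) = - (2 * int p^3 +
      3 * int p^2 + int p)"
  proof -
    assume *: "(\<Sum>i<p. \<Sum>j<p - i. (- 1) ^ (i + j + p) * ((2 * int i + 1) * (2 * int j + 1)))
      = - (\<Sum>i<p. (2 * int i + 1) * (int p - int i))"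
    have "6 * (\<Sum>i<p. (2 * int i + 1) * (int p - int i)) = 2 * int p^3 + 3 * int p^2 + int p"
      by (subst sum_rotated_even_alternating) algebra
    thus ?thesis unfolding * by simp
  qed
  have lin: "90 * (\<Sum>i<p. \<Sum>j<p - i. F i j + 2 * G i j)
    = 30 * (3 * (\<Sum>i<p. \<Sum>j<p - i. F i j)) + 30 * (6 * (\<Sum>i<p. \<Sum>j<p - i. G i j))"
    for F G :: "nat \<Rightarrow> nat \<Rightarrow> int"
    by (simp add: sum.distrib flip: sum_distrib_left)
  have "90 * (\<Sum>i<p. \<Sum>j<p - i. ((2 * int i + 1) * (2 * int j + 1))^2 + 1 +
      2 * ((- 1) ^ (i + j + p) * ((2 * int i + 1) * (2 * int j + 1))))
    = 30 * (3 * (\<Sum>i<p. \<Sum>j<p - i. ((2 * int i + 1) * (2 * int j + 1))^2 + 1))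
      + 30 * (6 * (\<Sum>i<p. \<Sum>j<p - i. (- 1) ^ (i + j + p) * ((2 * int i + 1) * (2 * int j + 1))))"
    by (rule lin)
  also have "\<dots> = 4 * (2 * int p^6 + 6 * int p^5 + 5 * int p^4 - 15 * int p^3 - 7 * int p^2 + 9 * int p)"
  proof -
    have e1: "30 * (\<Sum>i<p. ?P (2 * int i + 1) (int p - int i)) = 2 * (15 * (\<Sum>i<p. ?P (2 * int i + 1) (int p - int i)))"
      by simp
    have e2: "2 * (15 * (\<Sum>i<p. ?P (2 * int i + 1) (int p - int i))) + 30 * - (2 * int p^3 + 3 * int p^2 + int p)
        = 4 * (2 * int p^6 + 6 * int p^5 + 5 * int p^4 - 15 * int p^3 - 7 * int p^2 + 9 * int p)"
      by (subst sum_rotated_even_outer) algebra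
    show ?thesis unfolding sq alt e1 by (rule e2)
  qed
  finally show ?thesis .
qed

section \<open>Summation over the thresholds in size 4\<close>

lemma num_magic_squares_4:
  assumes n: "CARD('n::{finite,linorder}) = 4"
  shows "num_magic_squares TYPE('n) s =
    (\<Sum>p\<le>s. \<Sum>k\<le>s. \<Sum>l\<le>s. (card (cut_box p (s - p) k l))\<^sup>2)"
proof -
  have fin: "finite (fillings s P P' C R Q Q' D T)" for P P' C R Q Q' D T
    unfolding fillings_def by (auto intro!: finite_SigmaI finite_cartesian_product simp: finite_shell finite_transports)
  have fillings: "card (fillings s p (s - p) 0 0 (s - p) p 0 0) = (\<Sum>k\<le>s. \<Sum>l\<le>s. (card (cut_box p (s - p) k l))\<^sup>2)"
    if "p \<le> s" for p
  proof -
    have "card (shell s p (s - p) 0 0 k l) = card (cut_box p (s - p) k l)"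
      "card (shell s (s - p) p 0 0 l k) = card (cut_box p (s - p) k l)" for k l
      using card_shell_eq_box[of p "s - p" k l] card_shell_eq_box[of "s - p" p l k] that
      by (simp_all add: card_box_rotate)
    thus ?thesis by (subst card_fillings) (simp_all add: power2_eq_square)
  qed
  have inj: "inj_on (\<lambda>p. (p, s - p, s - p, p)) {..s}" by (auto intro: inj_onI)
  have splits: "splits4 s = (\<lambda>p. (p, s - p, s - p, p)) ` {..s}"
    by (auto simp: splits4_def image_iff)
  have "num_magic_squares TYPE('n) s = card (SIGMA (P, P', Q, Q') : splits4 s. fillings s P P' 0 0 Q Q' 0 0)"
    unfolding num_magic_squares_def by (rule bij_betw_same_card[OF magic_squares_4_bij[OF n], symmetric])
  also have "\<dots> = (\<Sum>p\<in>splits4 s. card (case p of (P, P', Q, Q') \<Rightarrow> fillings s P P' 0 0 Q Q' 0 0))"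
    by (subst card_SigmaI) (auto simp: fin splits)
  also have "\<dots> = (\<Sum>p\<le>s. card (fillings s p (s - p) 0 0 (s - p) p 0 0))"
    unfolding splits by (subst sum.reindex[OF inj]) simp
  also have "\<dots> = (\<Sum>p\<le>s. \<Sum>k\<le>s. \<Sum>l\<le>s. (card (cut_box p (s - p) k l))\<^sup>2)"
    by (intro sum.cong refl fillings) simp
  finally show ?thesis .
qed

lemma sum_reindex_Sigma:
  assumes "finite I" "\<And>i. i \<in> I \<Longrightarrow> finite (J i)"
    and "\<And>i j. i \<in> I \<Longrightarrow> j \<in> J i \<Longrightarrow> f i j \<in> A \<and> f' (f i j) = (i, j) \<and> g (f i j) = G i j"
    and "\<And>x. x \<in> A \<Longrightarrow> f' x \<in> Sigma I J \<and> f (fst (f' x)) (snd (f' x)) = x"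
  shows "sum g A = (\<Sum>i\<in>I. \<Sum>j\<in>J i. G i j)"
proof -
  have "sum g A = (\<Sum>(i, j)\<in>Sigma I J. G i j)"
  proof (rule sum.reindex_bij_witness[where i = "\<lambda>(i, j). f i j" and j = f'])
    fix x assume x: "x \<in> A"
    show "(case f' x of (i, j) \<Rightarrow> f i j) = x" "f' x \<in> Sigma I J"
      using assms(4)[OF x] by (auto simp: case_prod_unfold)
    show "(case f' x of (i, j) \<Rightarrow> G i j) = g x"
      using assms(4)[OF x] assms(3)[of "fst (f' x)" "snd (f' x)"] by (auto simp: case_prod_unfold mem_Sigma_iff)
  next
    fix b assume b: "b \<in> Sigma I J"
    show "f' (case b of (i, j) \<Rightarrow> f i j) = b" "(case b of (i, j) \<Rightarrow> f i j) \<in> A"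
      using b assms(3) by auto
  qed
  thus ?thesis using assms(1,2) by (simp add: sum.Sigma)
qed

lemma cut_box_empty: "p + q < 2 * k \<or> p + q < 2 * l \<Longrightarrow> cut_box p q k l = {}"
  by (auto simp: cut_box_def)

text \<open>The summation region is split according to which of the inequalities defining \<open>cut_box\<close> are active.\<close>

lemma sum_thresholds_split:
  fixes g :: "nat \<times> nat \<Rightarrow> int" and p h :: nat
  defines "I \<equiv> {..h} \<times> {..h}"
  assumes "p \<le> q" "p \<le> h"
  shows "sum g I =
    sum g {x \<in> I. fst x + snd x < p} +
    sum g {x \<in> I. snd x + p < fst x} + sum g {x \<in> I. fst x + p < snd x} +
    sum g {x \<in> I. q < fst x + snd x \<and> fst x \<le> snd x + p \<and> snd x \<le> fst x + p} +
    sum g {x \<in> I. p \<le> fst x + snd x \<and> fst x + snd x \<le> q \<and> fst x \<le> snd x + p \<and> snd x \<le> fst x + p \<and> even (fst x +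
        snd x + p)} +
    sum g {x \<in> I. p \<le> fst x + snd x \<and> fst x + snd x \<le> q \<and> fst x \<le> snd x + p \<and> snd x \<le> fst x + p \<and> odd (fst x +
        snd x + p)}"
proof -
  have fin: "finite I" by (simp add: I_def)
  show ?thesis
    unfolding sum.inter_filter[OF fin] sum.distrib[symmetric]
  proof (rule sum.cong[OF refl])
    fix x assume "x \<in> I"
    have split: "v = (if k + l < p then v else 0) + (if l + p < k then v else 0) + (if k + p < l then v else 0) +
        (if q < k + l \<and> k \<le> l + p \<and> l \<le> k + p then v else 0) +
        (if p \<le> k + l \<and> k + l \<le> q \<and> k \<le> l + p \<and> l \<le> k + p \<and> e then v else 0) +
        (if p \<le> k + l \<and> k + l \<le> q \<and> k \<le> l + p \<and> l \<le> k + p \<and> \<not> e then v else 0)"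
      for k l :: nat and e :: bool and v :: int
    proof -
      consider "k + l < p" | "l + p < k" | "k + p < l" | "p \<le> k + l" "k \<le> l + p" "l \<le> k + p" by linarith
      thus ?thesis
      proof cases
        case 4
        thus ?thesis by (cases "q < k + l"; cases e) simp_all
      qed (use assms(2) in simp_all)
    qed
    show "g x = (if fst x + snd x < p then g x else 0) +
      (if snd x + p < fst x then g x else 0) + (if fst x + p < snd x then g x else 0) +
      (if q < fst x + snd x \<and> fst x \<le> snd x + p \<and> snd x \<le> fst x + p then g x else 0) +
      (if p \<le> fst x + snd x \<and> fst x + snd x \<le> q \<and> fst x \<le> snd x + p \<and> snd x \<le> fst x + p \<and> even (fst x + snd x +
          p) then g x else 0) +
      (if p \<le> fst x + snd x \<and> fst x + snd x \<le> q \<and> fst x \<le> snd x + p \<and> snd x \<le> fst x + p \<and> odd (fst x + snd x +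
          p) then g x else 0)"
      by (rule split)
  qed
qed

text \<open>\<open>h\<close> is half of the magic sum \<open>p + q\<close>, rounded down, and
  \<open>c\<close> is its parity. Thresholds above \<open>h\<close> leave an empty box, which makes
  the distances \<open>h - k\<close> and \<open>h - l\<close> natural coordinates.\<close>

context
  fixes p n c q h :: nat and g :: "nat \<times> nat \<Rightarrow> int"
  assumes q: "q = p + 2 * n + c" and h: "h = p + n" and c: "c \<le> 1"
    and g: "g = (\<lambda>(k, l). (int (card (cut_box p q k l)))\<^sup>2)"
begin

lemma sum_corners:
  "sum g {x \<in> {..h} \<times> {..h}. fst x + snd x < p} =
    (\<Sum>k<p. \<Sum>l<p - k. ((int p + 1) * (int q + 1) - int k * (int k + 1) - int l * (int l + 1))^2)"
  by (rule sum_reindex_Sigma[where f = "\<lambda>k l. (k, l)" and f' = "\<lambda>x. x"])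
     (auto simp: g q h card_box_corners)

lemma card_strip:
  assumes "l + p < k" "k \<le> h"
  shows "int (card (cut_box p q k l)) = (int p + 1) * (2 * (int h - int k) + int c + 1)"
  using card_box_strip[of l p k q] assms by (simp add: q h)

lemma sum_strips:
  "sum g {x \<in> {..h} \<times> {..h}. snd x + p < fst x} =
    (\<Sum>i<n. \<Sum>j<n - i. ((int p + 1) * (2 * int i + int c + 1))^2)"
  "sum g {x \<in> {..h} \<times> {..h}. fst x + p < snd x} =
    (\<Sum>i<n. \<Sum>j<n - i. ((int p + 1) * (2 * int i + int c + 1))^2)"
proof -
  have eq: "int (card (cut_box p q (h - i) j)) = (int p + 1) * (2 * int i + int c + 1)"
    if "i < n" "j < n - i" for i j
    using card_strip[of j "h - i"] that by (simp add: h)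
  hence eq': "int (card (cut_box p q j (h - i))) = (int p + 1) * (2 * int i + int c + 1)"
    if "i < n" "j < n - i" for i j
    using that card_box_commute by metis
  show "sum g {x \<in> {..h} \<times> {..h}. snd x + p < fst x} =
    (\<Sum>i<n. \<Sum>j<n - i. ((int p + 1) * (2 * int i + int c + 1))^2)"
  proof (rule sum_reindex_Sigma[where f = "\<lambda>i j. (h - i, j)" and f' = "\<lambda>(k, l). (h - k, l)"], goal_cases)
    case (3 i j)
    thus ?case using eq[of i j] by (auto simp: g h)
  qed (auto simp: h)
  show "sum g {x \<in> {..h} \<times> {..h}. fst x + p < snd x} =
    (\<Sum>i<n. \<Sum>j<n - i. ((int p + 1) * (2 * int i + int c + 1))^2)"
  proof (rule sum_reindex_Sigma[where f = "\<lambda>i j. (j, h - i)" and f' = "\<lambda>(k, l). (h - l, k)"], goal_cases)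
    case (3 i j)
    thus ?case using eq'[of i j] by (auto simp: g h)
  qed (auto simp: h)
qed

lemma sum_middle_even:
  "sum g {x \<in> {..h} \<times> {..h}. p \<le> fst x + snd x \<and> fst x + snd x \<le> q \<and> fst x \<le> snd x + p \<and>
      snd x \<le> fst x + p \<and> even (fst x + snd x + p)} =
    (\<Sum>x<p + 1. \<Sum>y<n + 1.
      (((int p + 1) * (1 + int c) + 2 * int x * (int p - int x)) + 2 * (int p + 1) * int y)^2)"
proof (rule sum_reindex_Sigma[where f = "\<lambda>x y. (n - y + x, n - y + (p - x))"
      and f' = "\<lambda>(k, l). ((k + p - l) div 2, (2 * n + p - k - l) div 2)"], goal_cases)
  case (3 x y)
  then obtain x' z where x: "p = x + x'" "n = y + z"
    by (metis Suc_eq_plus1 le_iff_add lessThan_iff less_Suc_eq_le)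
  have "2 * z + 2 * y + x + x' + c = q" by (simp add: q x)
  hence "int (card (cut_box (x + x') q (z + x) (z + x')))
    = (int (x + x') + 1) * (2 * int y + 1 + int c) + 2 * int x * int x'"
    using card_box_middle_even[of x x' z y c] by simp
  hence "g (z + x, z + x') =
      (((int p + 1) * (1 + int c) + 2 * int x * (int p - int x)) + 2 * (int p + 1) * int y)^2"
    by (simp add: g x algebra_simps)
  thus ?case using c by (auto simp: q h x)
next
  case (4 x)
  obtain k l where kl: "x = (k, l)" by (cases x)
  have b: "k \<le> h" "l \<le> h" "p \<le> k + l" "k + l \<le> q" "k \<le> l + p" "l \<le> k + p" "even (k + l + p)"
    using 4 by (auto simp: kl)
  have "even (k + p - l)" using b(6,7) by auto
  then obtain i where i: "k + p - l = 2 * i" by blast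
  \<comment> \<open>For \<open>c = 1\<close> the extreme value \<open>k + l = q\<close> has the
    wrong parity; this is why \<open>y\<close> ranges up to \<open>n\<close> for both values of
    \<open>c\<close>.\<close>
  have "k + l \<le> 2 * n + p"
  proof (rule ccontr)
    assume "\<not> k + l \<le> 2 * n + p"
    hence "k + l = 2 * n + p + 1" using b(4) c by (simp add: q)
    thus False using b(7) by simp
  qed
  moreover from this have "even (2 * n + p - k - l)" using b(7) by auto
  then obtain y where y: "2 * n + p - k - l = 2 * y" by blast
  ultimately have "i \<le> p" "y \<le> n" "n - y + i = k" "n - y + (p - i) = l"
    using b i by linarith+
  moreover have "(k + p - l) div 2 = i" "(2 * n + p - k - l) div 2 = y"
    unfolding i y by simp_all
  ultimately show ?case
    unfolding kl prod.case fst_conv snd_conv mem_Sigma_iff by simp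
qed auto

text \<open>In this parity class the line \<open>k + l = q\<close> is attained when
  \<open>c = 1\<close> and contributes one more value of \<open>y\<close>, hence the bound
  \<open>n + c\<close>.\<close>

lemma sum_middle_odd:
  "sum g {x \<in> {..h} \<times> {..h}. p \<le> fst x + snd x \<and> fst x + snd x \<le> q \<and> fst x \<le> snd x + p \<and>
      snd x \<le> fst x + p \<and> odd (fst x + snd x + p)} =
    (\<Sum>x<p. \<Sum>y<n + c.
      (((int p + 1) * (1 - int c) + 2 * int p + 2 * int x * (int p - 1 - int x)) + 2 * (int p + 1) * int y)^2)"
proof (rule sum_reindex_Sigma[where f = "\<lambda>x y. (n + c - y + x, n + c - y + (p - 1 - x))"
      and f' = "\<lambda>(k, l). ((k + p - l) div 2, (2 * (n + c) + p - k - l) div 2)"], goal_cases)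
  case (3 x y)
  then obtain x' z where x: "p = x + x' + 1" "n + c = y + z + 1"
    by (metis add_Suc_right less_iff_Suc_add lessThan_iff Suc_eq_plus1)
  have "q + c = 2 * (z + 1) + 2 * y + x + x' + 1" using x by (simp add: q)
  hence "int (card (cut_box (x + x' + 1) q (z + 1 + x) (z + 1 + x')))
    = (int (x + x') + 2) * (2 * int y + 1 - int c) + 2 * (int (x + x') + 1) + 2 * int x * int x'"
    using c by (rule card_box_middle_odd)
  hence "g (z + 1 + x, z + 1 + x') = 
     (((int p + 1) * (1 - int c) + 2 * int p + 2 * int x * (int p - 1 - int x)) + 2 * (int p + 1) * int y)^2"
    by (simp add: g x algebra_simps)
  moreover have "n + c - y + x = z + 1 + x" "n + c - y + (p - 1 - x) = z + 1 + x'" using x by linarith+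
  moreover have "z + 1 + x \<le> h" "z + 1 + x' \<le> h" "z + 1 + x + (z + 1 + x') \<le> q"
    using x c by (simp_all add: h q)
  moreover have "(z + 1 + x + p - (z + 1 + x')) div 2 = x" "(2 * (n + c) + p - (z + 1 + x) - (z + 1 + x')) div 2 = y"
    unfolding x by simp_all
  moreover have "odd (z + 1 + x + (z + 1 + x') + p)" unfolding x by auto
  ultimately show ?case using x(1) by auto
next
  case (4 x)
  obtain k l where kl: "x = (k, l)" by (cases x)
  have b: "k \<le> h" "l \<le> h" "p \<le> k + l" "k + l \<le> q" "k \<le> l + p" "l \<le> k + p" "odd (k + l + p)"
    using 4 by (auto simp: kl)
  have "odd (k + p - l)" using b(6,7) by auto
  then obtain i where i: "k + p - l = 2 * i + 1" by (blast elim: oddE)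
  have le: "k + l \<le> 2 * (n + c) + p" using b(4) by (simp add: q)
  hence "odd (2 * (n + c) + p - k - l)" using b(7) by auto
  then obtain y where y: "2 * (n + c) + p - k - l = 2 * y + 1" by (blast elim: oddE)
  have "k \<noteq> l + p" "p \<noteq> k + l" using b(7) by auto
  moreover have "2 * n + 2 * c + p = k + l + 2 * y + 1" using y by (simp add: add_mult_distrib2)
  moreover have "k + p = l + 2 * i + 1" using i by simp
  ultimately have "i < p" "y < n + c" "n + c - y + i = k" "n + c - y + (p - 1 - i) = l"
    using b(3-6) by linarith+
  moreover have "(k + p - l) div 2 = i" "(2 * (n + c) + p - k - l) div 2 = y"
    unfolding i y by simp_all
  ultimately show ?case
    unfolding kl prod.case fst_conv snd_conv mem_Sigma_iff by simp
qed auto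

lemma sum_rotated:
  "sum g {x \<in> {..h} \<times> {..h}. q < fst x + snd x \<and> fst x \<le> snd x + p \<and> snd x \<le> fst x + p} =
    (\<Sum>i<p. \<Sum>j<p - c - i. g (h - i, h - j))"
  by (rule sum_reindex_Sigma[where f = "\<lambda>i j. (h - i, h - j)" and f' = "\<lambda>(k, l). (h - k, h - l)"])
     (auto simp: q h)

text \<open>The rotated rectangle has sides \<open>2 * i + c\<close> and \<open>2 * j + c\<close>.
  Both are odd for \<open>c = 1\<close>, so the sign term of \<open>card_parity\<close> survives
  only for \<open>c = 0\<close>.\<close>

lemma card_rotated:
  assumes "i + j + c < p"
  shows "2 * int (card (cut_box p q (h - i) (h - j))) =
    (2 * int i + int c + 1) * (2 * int j + int c + 1) + (if c = 0 then (- 1) ^ (i + j + p) else 0)"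
proof -
  have ex: "p + q - 2 * (h - i) = 2 * i + c" "p + q - 2 * (h - j) = 2 * j + c"
    using assms by (auto simp: q h)
  have le: "p \<le> q" "q \<le> (h - i) + (h - j)" "2 * (h - i) \<le> p + q" "2 * (h - j) \<le> p + q"
    using assms by (auto simp: q h)
  have pow: "(- 1 :: int) ^ (h - i + (h - j) + q) = (- 1) ^ (i + j + p)" if "c = 0"
  proof -
    define m where "m = h - i + (h - j) + q"
    have "m + (i + j + p) = 2 * (h + p + n)"
      using assms that by (simp add: m_def q h)
    hence "even (m + (i + j + p))" by (simp only: dvd_triv_left)
    hence "even m \<longleftrightarrow> even (i + j + p)" by (simp only: even_add)
    thus ?thesis unfolding m_def[symmetric] by (simp only: minus_one_power_iff)
  qed
  have "c = 0 \<or> c = 1" using c by auto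
  thus ?thesis
    unfolding card_box_rotated[OF le, unfolded ex] card_parity using pow by auto
qed

lemma sum_all:
  "(\<Sum>k\<le>p + q. \<Sum>l\<le>p + q. g (k, l)) = sum g ({..h} \<times> {..h})"
proof -
  have "(\<Sum>k\<le>p + q. \<Sum>l\<le>p + q. g (k, l)) = sum g ({..p + q} \<times> {..p + q})"
    by (simp add: sum.cartesian_product)
  also have "\<dots> = sum g ({..h} \<times> {..h})"
  proof (intro sum.mono_neutral_right ballI)
    fix x assume x: "x \<in> {..p + q} \<times> {..p + q} - {..h} \<times> {..h}"
    have "p + q < 2 * fst x \<or> p + q < 2 * snd x" using x c by (auto simp: q h)
    thus "g x = 0" by (cases x) (auto simp: g cut_box_empty)
  qed (auto simp: q h)
  finally show ?thesis .
qed

lemma sum_thresholds: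
  "(\<Sum>k\<le>p + q. \<Sum>l\<le>p + q. (int (card (cut_box p q k l)))\<^sup>2) =
    (\<Sum>k<p. \<Sum>l<p - k. ((int p + 1) * (int q + 1) - int k * (int k + 1) - int l * (int l + 1))^2) +
    2 * (\<Sum>i<n. \<Sum>j<n - i. ((int p + 1) * (2 * int i + int c + 1))^2) +
    (\<Sum>i<p. \<Sum>j<p - c - i. (int (card (cut_box p q (h - i) (h - j))))\<^sup>2) +
    (\<Sum>x<p + 1. \<Sum>y<n + 1.
      (((int p + 1) * (1 + int c) + 2 * int x * (int p - int x)) + 2 * (int p + 1) * int y)^2) +
    (\<Sum>x<p. \<Sum>y<n + c.
      (((int p + 1) * (1 - int c) + 2 * int p + 2 * int x * (int p - 1 - int x)) + 2 * (int p + 1) * int y)^2)"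
proof -
  have "p \<le> q" "p \<le> h" by (simp_all add: q h)
  from sum_all sum_thresholds_split[OF this, of g] show ?thesis
    unfolding sum_corners sum_strips sum_middle_even sum_middle_odd sum_rotated
    by (simp only: g prod.case)
qed

end

section \<open>Section sums as polynomials\<close>

lemma square_of_half: "2 * N = a + e \<Longrightarrow> e * e = 1 \<Longrightarrow> 4 * N^2 = a^2 + 1 + 2 * (e * a)" for N a e :: int
  by algebra

text \<open>90 clears the denominators of all five partial sums; 30 suffices for the two middle
  ones.\<close>

lemma ninety_sections:
  "90 * (a + 2 * b + r + m1 + m2) = 90 * a + 2 * (90 * b) + 90 * r + 3 * (30 * m1) + 3 * (30 * m2)"
  for a b r m1 m2 :: int
  by simp

lemma double_sum_strip:
  "90 * (\<Sum>i<n. \<Sum>j<n - i. ((int p + 1) * (2 * int i + int c + 1))^2) = 60 * int c * int n^3 * int p^2 + 45 * int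
      c^2 * int n^2 * int p^2 + 30 * int n^4 * int p^2 + 90
    * int c * int n^2 * int p^2 + 120 * int c * int n^3 * int p + 45 * int c^2 * int n * int p^2 +
    90 * int c^2 * int n^2 * int p + 60 * int n^3 * int p^2 + 60 * int n^4 * int p + 30 * int c *
    int n * int p^2 + 180 * int c * int n^2 * int p + 60 * int c * int n^3 + 90 * int c^2 * int n *
    int p + 45 * int c^2 * int n^2 + 15 * int n^2 * int p^2 + 120 * int n^3 * int p + 30 * int n^4 +
    60 * int c * int n * int p + 90 * int c * int n^2 + 45 * int c^2 * int n - 15 * int n * int p^2
    + 30 * int n^2 * int p + 60 * int n^3 + 30 * int c * int n - 30 * int n * int p + 15 * int n^2 -
    15 * int n"
proof -
  have "90 * (\<Sum>i<n. \<Sum>j<n - i. ((int p + 1) * (2 * int i + int c + 1))^2)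
      = 15 * (6 * (\<Sum>i<n. (int n - int i) * ((int p + 1) * (2 * int i + int c + 1))^2))"
    by (simp add: of_nat_diff)
  also have "\<dots> = 60 * int c * int n^3 * int p^2 + 45 * int c^2 * int n^2 * int p^2 + 30 * int n^4 * int p^2 + 90
    * int c * int n^2 * int p^2 + 120 * int c * int n^3 * int p + 45 * int c^2 * int n * int p^2 +
    90 * int c^2 * int n^2 * int p + 60 * int n^3 * int p^2 + 60 * int n^4 * int p + 30 * int c *
    int n * int p^2 + 180 * int c * int n^2 * int p + 60 * int c * int n^3 + 90 * int c^2 * int n *
    int p + 45 * int c^2 * int n^2 + 15 * int n^2 * int p^2 + 120 * int n^3 * int p + 30 * int n^4 +
    60 * int c * int n * int p + 90 * int c * int n^2 + 45 * int c^2 * int n - 15 * int n * int p^2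
    + 30 * int n^2 * int p + 60 * int n^3 + 30 * int c * int n - 30 * int n * int p + 15 * int n^2 -
    15 * int n"
    by (subst sum_strip) algebra
  finally show ?thesis .
qed

text \<open>The result is expanded in \<open>p\<close> and \<open>p + n\<close> because
  \<open>p + n\<close>, half of the magic sum, stays fixed in the subsequent summation over
  \<open>p\<close>.\<close>

lemma section_sum_even:
  fixes p n :: nat
  defines "q \<equiv> p + 2 * n"
  shows "15 * (\<Sum>k\<le>p + q. \<Sum>l\<le>p + q. (int (card (cut_box p q k l)))\<^sup>2) = 4 * (int p + int n) * int p^5 - 10 * (int
      p + int n)^2 * int p^4 + 10 * (int p + int n)^4 * int
    p^2 - 40 * (int p + int n)^2 * int p^3 + 40 * (int p + int n)^3 * int p^2 + 20 * (int p + int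
    n)^4 * int p + 4 * int p^5 - 50 * (int p + int n) * int p^3 + 15 * (int p + int n)^2 * int p^2 +
    80 * (int p + int n)^3 * int p + 10 * (int p + int n)^4 + 10 * int p^4 - 40 * (int p + int n) *
    int p^2 + 110 * (int p + int n)^2 * int p + 40 * (int p + int n)^3 - 10 * int p^3 + 56 * (int p
    + int n) * int p + 65 * (int p + int n)^2 - 25 * int p^2 + 50 * (int p + int n) + 6 * int p + 15" (is "15 *
        ?s = ?rhs")
proof -
  have q: "q = p + 2 * n + 0" by (simp add: q_def)
  have iq: "int q = int p + 2 * int n" by (simp add: q_def)
  let ?r = "\<Sum>i<p. \<Sum>j<p - 0 - i. (int (card (cut_box p q (p + n - i) (p + n - j))))\<^sup>2"
  have "4 * (int (card (cut_box p q (p + n - i) (p + n - j))))\<^sup>2 =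
     ((2 * int i + 1) * (2 * int j + 1))^2 + 1 + 2 * ((- 1) ^ (i + j + p) * ((2 * int i + 1) * (2 * int j + 1)))"
    if "i + j < p" for i j
  proof -
    let ?N = "int (card (cut_box p q (p + n - i) (p + n - j)))" and ?e = "(- 1 :: int) ^ (i + j + p)"
    have "2 * ?N = (2 * int i + 1) * (2 * int j + 1) + ?e"
      using card_rotated[OF q refl _ refl, of i j] that by simp
    moreover have "?e * ?e = 1" by (simp flip: power_mult_distrib)
    ultimately show ?thesis by (rule square_of_half)
  qed
  hence "4 * ?r = (\<Sum>i<p. \<Sum>j<p - i. ((2 * int i + 1) * (2 * int j + 1))^2 + 1 +
      2 * ((- 1) ^ (i + j + p) * ((2 * int i + 1) * (2 * int j + 1))))"
    unfolding sum_distrib_left by (intro sum.cong) auto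
  hence "90 * (4 * ?r) = 4 * (2 * int p^6 + 6 * int p^5 + 5 * int p^4 - 15 * int p^3 - 7 * int p^2 + 9 * int p)"
    by (simp only: double_sum_rotated_even)
  hence r: "90 * ?r = 2 * int p^6 + 6 * int p^5 + 5 * int p^4 - 15 * int p^3 - 7 * int p^2 + 9 * int p" by simp
  have "6 * (15 * ?s) = 90 * ?s" by simp
  also have "\<dots> = 6 * ?rhs"
    unfolding sum_thresholds[OF q refl zero_le_one refl] ninety_sections
      double_sum_corners double_sum_strip r double_sum_middle
    by (simp only: of_nat_add of_nat_0 of_nat_1 iq power_one mult_1_right mult_1 diff_self diff_zero
          add_0_right mult_zero_right mult_zero_left one_add_one power_0_left numeral_eq_one_iff zero_power2)
              (simp add: algebra_simps eval_nat_numeral)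
  finally show ?thesis by simp
qed

lemma section_sum_odd:
  fixes p n :: nat
  defines "q \<equiv> p + 2 * n + 1"
  shows "30 * (\<Sum>k\<le>p + q. \<Sum>l\<le>p + q. (int (card (cut_box p q k l)))\<^sup>2) = 8 * (int p + int n) * int p^5 - 20 * (int
      p + int n)^2 * int p^4 + 20 * (int p + int n)^4 * int
    p^2 - 20 * (int p + int n) * int p^4 - 80 * (int p + int n)^2 * int p^3 + 120 * (int p + int
    n)^3 * int p^2 + 40 * (int p + int n)^4 * int p + 12 * int p^5 - 180 * (int p + int n) * int p^3
    + 180 * (int p + int n)^2 * int p^2 + 240 * (int p + int n)^3 * int p + 20 * (int p + int n)^4 +
    15 * int p^4 + 20 * (int p + int n) * int p^2 + 520 * (int p + int n)^2 * int p + 120 * (int p +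
    int n)^3 - 90 * int p^3 + 472 * (int p + int n) * int p + 280 * (int p + int n)^2 - 75 * int p^2
    + 300 * (int p + int n) + 138 * int p + 120" (is "30 * ?s = ?rhs")
proof -
  have q: "q = p + 2 * n + 1" by (simp add: q_def)
  have iq: "int q = int p + 2 * int n + 1" by (simp add: q_def)
  let ?r = "\<Sum>i<p. \<Sum>j<p - 1 - i. (int (card (cut_box p q (p + n - i) (p + n - j))))\<^sup>2"
  have "int (card (cut_box p q (p + n - i) (p + n - j))) = 2 * ((int i + 1) * (int j + 1))"
    if "i + j + 1 < p" for i j
    using card_rotated[OF q refl _ refl, of i j] that by (simp add: algebra_simps)
  hence "?r = (\<Sum>i<p. \<Sum>j<p - 1 - i. (2 * ((int i + 1) * (int j + 1)))^2)"
    by (intro sum.cong) auto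
  hence r: "90 * ?r = 2 * int p^6 + 6 * int p^5 + 5 * int p^4 - 7 * int p^2 - 6 * int p"
    by (simp only: double_sum_rotated_odd)
  have "3 * (30 * ?s) = 90 * ?s" by simp
  also have "\<dots> = 3 * ?rhs"
    unfolding sum_thresholds[OF q refl order_refl refl] ninety_sections
      double_sum_corners double_sum_strip r double_sum_middle
    by (simp only: of_nat_add of_nat_0 of_nat_1 iq power_one mult_1_right mult_1 diff_self diff_zero
          add_0_right mult_zero_right mult_zero_left one_add_one power_0_left numeral_eq_one_iff zero_power2) algebra
  finally show ?thesis by simp
qed

section \<open>Four by four squares\<close>

text \<open>This symmetry under exchanging \<open>p\<close> and \<open>s - p\<close> reduces the sum
  over \<open>p\<close> to the sections with \<open>p \<le> q\<close>, for which closed forms are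
  available.\<close>

lemma section_swap:
  "(\<Sum>k\<le>s. \<Sum>l\<le>s. (int (card (cut_box q p k l)))\<^sup>2) = (\<Sum>k\<le>s. \<Sum>l\<le>s. (int (card (cut_box p q k l)))\<^sup>2)"
  by (simp only: card_box_swap)

lemma sum_palindrome_even:
  fixes f :: "nat \<Rightarrow> int"
  assumes "\<And>p. p < h \<Longrightarrow> f (2 * h - p) = f p"
  shows "sum f {..2 * h} = 2 * sum f {..<h} + f h"
proof -
  have upper: "sum f {h<..2 * h} = sum f {..<h}"
  proof (rule sum.reindex_bij_witness[where i = "\<lambda>p. 2 * h - p" and j = "\<lambda>p. 2 * h - p"])
    show "f (2 * h - a) = f a" if "a \<in> {h<..2 * h}" for a
      using assms[of "2 * h - a"] that by auto
  qed auto
  have "{..2 * h} = {..<h} \<union> {h..2 * h}" "{h..2 * h} = insert h {h<..2 * h}" by auto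
  moreover have "sum f ({..<h} \<union> {h..2 * h}) = sum f {..<h} + sum f {h..2 * h}"
    by (rule sum.union_disjoint) auto
  ultimately show ?thesis using upper by simp
qed

lemma sum_palindrome_odd:
  fixes f :: "nat \<Rightarrow> int"
  assumes "\<And>p. p \<le> h \<Longrightarrow> f (2 * h + 1 - p) = f p"
  shows "sum f {..2 * h + 1} = 2 * sum f {..<Suc h}"
proof -
  have upper: "sum f {h<..2 * h + 1} = sum f {..<Suc h}"
  proof (rule sum.reindex_bij_witness[where i = "\<lambda>p. 2 * h + 1 - p" and j = "\<lambda>p. 2 * h + 1 - p"])
    show "f (2 * h + 1 - a) = f a" if "a \<in> {h<..2 * h + 1}" for a
      using assms[of "2 * h + 1 - a"] that by auto
  qed auto
  have "{..2 * h + 1} = {..<Suc h} \<union> {h<..2 * h + 1}" by auto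
  moreover have "sum f ({..<Suc h} \<union> {h<..2 * h + 1}) = sum f {..<Suc h} + sum f {h<..2 * h + 1}"
    by (rule sum.union_disjoint) auto
  ultimately show ?thesis using upper by simp
qed

lemma num_magic_squares_4_even:
  assumes n: "CARD('n::{finite,linorder}) = 4"
  shows "15 * int (num_magic_squares TYPE('n) (2 * h)) =
    4 * int h^7 + 28 * int h^6 + 89 * int h^5 + 165 * int h^4 + 196 * int h^3 + 152 * int h^2 + 71 * int h + 15"
proof -
  let ?S = "\<lambda>p. \<Sum>k\<le>2 * h. \<Sum>l\<le>2 * h. (int (card (cut_box p (2 * h - p) k l)))\<^sup>2"
  have "int (num_magic_squares TYPE('n) (2 * h)) = (\<Sum>p\<le>2 * h. ?S p)"
    by (simp only: num_magic_squares_4[OF n] of_nat_sum of_nat_power)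
  also have "\<dots> = 2 * sum ?S {..<h} + ?S h"
  proof (rule sum_palindrome_even)
    fix p assume "p < h"
    thus "?S (2 * h - p) = ?S p" by (subst section_swap) simp
  qed
  finally have total: "int (num_magic_squares TYPE('n) (2 * h)) = 2 * sum ?S {..<h} + ?S h" .
  have sec: "15 * ?S p = 4 * int h * int p^5 - 10 * int h^2 * int p^4 + 10 * int h^4 * int p^2 - 40 * int h^2 *
      int p^3 +
    40 * int h^3 * int p^2 + 20 * int h^4 * int p + 4 * int p^5 - 50 * int h * int p^3 + 15 * int
    h^2 * int p^2 + 80 * int h^3 * int p + 10 * int h^4 + 10 * int p^4 - 40 * int h * int p^2 + 110
    * int h^2 * int p + 40 * int h^3 - 10 * int p^3 + 56 * int h * int p + 65 * int h^2 - 25 * int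
    p^2 + 50 * int h + 6 * int p + 15" if "p \<le> h" for p
  proof -
    have *: "p + 2 * (h - p) = 2 * h - p" "p + (2 * h - p) = 2 * h" "int p + int (h - p) = int h"
      using that by auto
    show ?thesis using section_sum_even[of p "h - p"] unfolding * .
  qed
  have "15 * int (num_magic_squares TYPE('n) (2 * h)) * 6 = 2 * (6 * (\<Sum>p<h. 15 * ?S p)) + 6 * (15 * ?S h)"
    unfolding total by (simp flip: sum_distrib_left)
  also have "(\<Sum>p<h. 15 * ?S p) = (\<Sum>p<h. 4 * int h * int p^5 - 10 * int h^2 * int p^4 + 10 * int h^4 * int p^2 -
      40 * int h^2 * int p^3 +
    40 * int h^3 * int p^2 + 20 * int h^4 * int p + 4 * int p^5 - 50 * int h * int p^3 + 15 * int
    h^2 * int p^2 + 80 * int h^3 * int p + 10 * int h^4 + 10 * int p^4 - 40 * int h * int p^2 + 110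
    * int h^2 * int p + 40 * int h^3 - 10 * int p^3 + 56 * int h * int p + 65 * int h^2 - 25 * int
    p^2 + 50 * int h + 6 * int p + 15)"
    by (intro sum.cong refl sec) simp
  also have "2 * (6 * \<dots>) + 6 * (15 * ?S h) = 6 *
    (4 * int h^7 + 28 * int h^6 + 89 * int h^5 + 165 * int h^4 + 196 * int h^3 + 152 * int h^2 + 71 * int h + 15)"
    unfolding sum_sections_even sec[OF order_refl] by algebra
  finally show ?thesis by simp
qed

lemma num_magic_squares_4_odd:
  assumes n: "CARD('n::{finite,linorder}) = 4"
  shows "15 * int (num_magic_squares TYPE('n) (2 * h + 1)) =
    4 * int h^7 + 42 * int h^6 + 194 * int h^5 + 510 * int h^4 + 826 * int h^3 + 828 * int h^2 + 476 * int h + 120"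
proof -
  let ?s = "2 * h + 1"
  let ?S = "\<lambda>p. \<Sum>k\<le>?s. \<Sum>l\<le>?s. (int (card (cut_box p (?s - p) k l)))\<^sup>2"
  have "int (num_magic_squares TYPE('n) ?s) = (\<Sum>p\<le>?s. ?S p)"
    by (simp only: num_magic_squares_4[OF n] of_nat_sum of_nat_power)
  also have "\<dots> = 2 * sum ?S {..<Suc h}"
  proof (rule sum_palindrome_odd)
    fix p assume "p \<le> h"
    thus "?S (?s - p) = ?S p" by (subst section_swap) simp
  qed
  finally have total: "int (num_magic_squares TYPE('n) ?s) = 2 * sum ?S {..<Suc h}" .
  have sec: "30 * ?S p = 8 * int h * int p^5 - 20 * int h^2 * int p^4 + 20 * int h^4 * int p^2 - 20 * int h * int p^4 -
    80 * int h^2 * int p^3 + 120 * int h^3 * int p^2 + 40 * int h^4 * int p + 12 * int p^5 - 180 *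
    int h * int p^3 + 180 * int h^2 * int p^2 + 240 * int h^3 * int p + 20 * int h^4 + 15 * int p^4
    + 20 * int h * int p^2 + 520 * int h^2 * int p + 120 * int h^3 - 90 * int p^3 + 472 * int h *
    int p + 280 * int h^2 - 75 * int p^2 + 300 * int h + 138 * int p + 120" if "p \<le> h" for p
  proof -
    have *: "p + 2 * (h - p) + 1 = 2 * h + 1 - p" "p + (2 * h + 1 - p) = 2 * h + 1" "int p + int (h - p) = int h"
      using that by auto
    show ?thesis using section_sum_odd[of p "h - p"] unfolding * .
  qed
  have scale: "15 * (2 * a) * 3 = 3 * (30 * a)" for a :: int by simp
  have "15 * int (num_magic_squares TYPE('n) ?s) * 3 = 3 * (\<Sum>p<Suc h. 30 * ?S p)"
    unfolding total sum_distrib_left[symmetric] by (rule scale)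
  also have "(\<Sum>p<Suc h. 30 * ?S p) = (\<Sum>p<Suc h. 8 * int h * int p^5 - 20 * int h^2 * int p^4 + 20 * int h^4 *
      int p^2 - 20 * int h * int p^4 -
    80 * int h^2 * int p^3 + 120 * int h^3 * int p^2 + 40 * int h^4 * int p + 12 * int p^5 - 180 *
    int h * int p^3 + 180 * int h^2 * int p^2 + 240 * int h^3 * int p + 20 * int h^4 + 15 * int p^4
    + 20 * int h * int p^2 + 520 * int h^2 * int p + 120 * int h^3 - 90 * int p^3 + 472 * int h *
    int p + 280 * int h^2 - 75 * int p^2 + 300 * int h + 138 * int p + 120)"
    by (intro sum.cong refl sec) simp
  also have "3 * \<dots> = 3 *
    (4 * int h^7 + 42 * int h^6 + 194 * int h^5 + 510 * int h^4 + 826 * int h^3 + 828 * int h^2 + 476 * int h + 120)"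
    unfolding sum_sections_odd of_nat_Suc by algebra
  finally show ?thesis by simp
qed

section \<open>The quasi-polynomial and its generating function\<close>

definition quasi480 :: "nat \<Rightarrow> rat" where
  "quasi480 s = (let x = rat_of_nat s in
     if even s then x^7 + 14 * x^6 + 89 * x^5 + 330 * x^4 + 784 * x^3 + 1216 * x^2 + 1136 * x + 480
     else x^7 + 14 * x^6 + 89 * x^5 + 330 * x^4 + 779 * x^3 + 1186 * x^2 + 1051 * x + 390)"

definition quasi4 :: "nat \<Rightarrow> rat" where
  "quasi4 s = quasi480 s / 480"

lemma num_magic_squares_4_quasi4:
  assumes n: "CARD('n::{finite,linorder}) = 4"
  shows "rat_of_nat (num_magic_squares TYPE('n) s) = quasi4 s"
proof -
  let ?N = "rat_of_nat (num_magic_squares TYPE('n) s)"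
  have "480 * ?N = quasi480 s"
  proof (cases "even s")
    case True
    then obtain h where s: "s = 2 * h" by blast
    define y x where "y = rat_of_nat h" and "x = 2 * y"
    have "rat_of_int (15 * int (num_magic_squares TYPE('n) s)) = rat_of_int
      (4 * int h^7 + 28 * int h^6 + 89 * int h^5 + 165 * int h^4 + 196 * int h^3 + 152 * int h^2 + 71 * int h + 15)"
      unfolding s num_magic_squares_4_even[OF n] ..
    hence "15 * ?N = 4 * y^7 + 28 * y^6 + 89 * y^5 + 165 * y^4 + 196 * y^3 + 152 * y^2 + 71 * y + 15"
      by (simp add: y_def)
    with x_def have "480 * ?N = x^7 + 14 * x^6 + 89 * x^5 + 330 * x^4 + 784 * x^3 + 1216 * x^2 + 1136 * x + 480"
      by algebra
    thus ?thesis by (simp add: quasi480_def s x_def y_def)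
  next
    case False
    then obtain h where s: "s = 2 * h + 1" by (blast elim: oddE)
    define y x where "y = rat_of_nat h" and "x = 2 * y + 1"
    have "rat_of_int (15 * int (num_magic_squares TYPE('n) s)) = rat_of_int
      (4 * int h^7 + 42 * int h^6 + 194 * int h^5 + 510 * int h^4 + 826 * int h^3 + 828 * int h^2 + 476 * int h + 120)"
      unfolding s num_magic_squares_4_odd[OF n] ..
    hence "15 * ?N = 4 * y^7 + 42 * y^6 + 194 * y^5 + 510 * y^4 + 826 * y^3 + 828 * y^2 + 476 * y + 120"
      by (simp add: y_def)
    with x_def have "480 * ?N = x^7 + 14 * x^6 + 89 * x^5 + 330 * x^4 + 779 * x^3 + 1186 * x^2 + 1051 * x + 390"
      by algebra
    moreover have "rat_of_nat s = x" by (simp add: s x_def y_def)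
    ultimately show ?thesis using False by (simp add: quasi480_def)
  qed
  thus ?thesis by (simp add: quasi4_def)
qed

text \<open>The coefficients are those of \<open>(1 - X)^8 * (1 + X)^4\<close>, which is the
  denominator. The first factor annihilates polynomials of degree below 8, the second one
  \<open>(- 1)^k\<close> times a cubic polynomial, and the two branches agree from degree 4
  on.\<close>

lemma quasi480_recurrence:
  "quasi480 (k + 12) - 4 * quasi480 (k + 11) + 2 * quasi480 (k + 10) + 12 * quasi480 (k + 9) - 17 * quasi480 (k
      + 8) - 8 * quasi480 (k + 7) + 28 * quasi480 (k + 6) - 8 * quasi480 (k + 5) - 17 * quasi480 (k + 4) + 12 *
          quasi480 (k + 3) + 2 * quasi480 (k + 2) - 4 * quasi480 (k + 1) + quasi480 k = 0"
proof (cases "even k")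
  case True
  show ?thesis by (simp add: quasi480_def True Let_def) algebra
next
  case False
  show ?thesis by (simp add: quasi480_def False Let_def) algebra
qed

lemma quasi4_recurrence:
  "quasi4 (k + 12) - 4 * quasi4 (k + 11) + 2 * quasi4 (k + 10) + 12 * quasi4 (k + 9) - 17 * quasi4 (k + 8) - 8 *
      quasi4 (k + 7) + 28 * quasi4 (k + 6) - 8 * quasi4 (k + 5) - 17 * quasi4 (k + 4) + 12 * quasi4 (k + 3) + 2
          * quasi4 (k + 2) - 4 * quasi4 (k + 1) + quasi4 k = 0"
  using quasi480_recurrence[of k] unfolding quasi4_def by linarith

lemma denominator_expand:
  "(1 - X) ^ 4 * (1 - X\<^sup>2) ^ 4 = 1 - 4 * X + 2 * X^2 + 12 * X^3 - 17 * X^4 - 8 * X^5 + 28 * X^6 - 8 * X^7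
     - 17 * X^8 + 12 * X^9 + 2 * X^10 - 4 * X^11 + X^12" for X :: "'a::comm_ring_1"
  by (simp add: algebra_simps eval_nat_numeral)

lemma quasi4_fps:
  "Abs_fps quasi4 = (fps_X ^ 8 + 4 * fps_X ^ 7 + 18 * fps_X ^ 6 + 36 * fps_X ^ 5 + 50 * fps_X ^ 4
             + 36 * fps_X ^ 3 + 18 * fps_X ^ 2 + 4 * fps_X + 1)
           / ((1 - fps_X) ^ 4 * (1 - fps_X ^ 2) ^ 4)" (is "?F = ?N / ?D")
proof -
  have "?F * ?D = ?F - fps_const 4 * (fps_X ^ 1 * ?F) + fps_const 2 * (fps_X ^ 2 * ?F)
     + fps_const 12 * (fps_X ^ 3 * ?F) - fps_const 17 * (fps_X ^ 4 * ?F) - fps_const 8 * (fps_X ^ 5 * ?F)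
     + fps_const 28 * (fps_X ^ 6 * ?F) - fps_const 8 * (fps_X ^ 7 * ?F) - fps_const 17 * (fps_X ^ 8 * ?F)
     + fps_const 12 * (fps_X ^ 9 * ?F) + fps_const 2 * (fps_X ^ 10 * ?F) - fps_const 4 * (fps_X ^ 11 * ?F)
     + fps_X ^ 12 * ?F"
    unfolding denominator_expand numeral_fps_const[symmetric] by (simp add: algebra_simps)
  also have "\<dots> = ?N"
  proof (rule fps_ext)
    fix i :: nat
    \<comment> \<open>From coefficient 12 on the recurrence gives 0, in accordance with the degree 8
      of the numerator; the first twelve coefficients are computed.\<close>
    have "i \<in> {0, 1, 2, 3, 4, 5, 6, 7, 8, 9, 10, 11} \<or> i = (i - 12) + 12"
      unfolding insert_iff empty_iff by presburger
    then consider "i \<in> {0, 1, 2, 3, 4, 5, 6, 7, 8, 9, 10, 11}" | k where "i = k + 12" by blast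
    thus "fps_nth (?F - fps_const 4 * (fps_X ^ 1 * ?F) + fps_const 2 * (fps_X ^ 2 * ?F)
     + fps_const 12 * (fps_X ^ 3 * ?F) - fps_const 17 * (fps_X ^ 4 * ?F) - fps_const 8 * (fps_X ^ 5 * ?F)
     + fps_const 28 * (fps_X ^ 6 * ?F) - fps_const 8 * (fps_X ^ 7 * ?F) - fps_const 17 * (fps_X ^ 8 * ?F)
     + fps_const 12 * (fps_X ^ 9 * ?F) + fps_const 2 * (fps_X ^ 10 * ?F) - fps_const 4 * (fps_X ^ 11 * ?F)
     + fps_X ^ 12 * ?F) i = fps_nth ?N i"
    proof cases
      case 1
      thus ?thesis
        by (auto simp: fps_X_power_mult_nth numeral_fps_const quasi4_def quasi480_def)
    next
      case 2
      thus ?thesis using quasi4_recurrence[of k]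
        by (simp add: fps_X_power_mult_nth numeral_fps_const add.commute[of _ k])
    qed
  qed
  finally have FD: "?F * ?D = ?N" .
  have "fps_nth (1 - fps_X :: rat fps) 0 = 1" "fps_nth (1 - fps_X\<^sup>2 :: rat fps) 0 = 1" by simp_all
  hence "1 - fps_X \<noteq> (0 :: rat fps)" "1 - fps_X\<^sup>2 \<noteq> (0 :: rat fps)" by (metis fps_zero_nth zero_neq_one)+
  hence "?D \<noteq> 0" by simp
  thus ?thesis unfolding FD[symmetric] by simp
qed

lemma quasi4_cutoff:
  "fps_cutoff 9 (Abs_fps quasi4) = 1 + 8 * fps_X + 48 * fps_X ^ 2 + 200 * fps_X ^ 3 + 675 * fps_X ^ 4
             + 1904 * fps_X ^ 5 + 4736 * fps_X ^ 6 + 10608 * fps_X ^ 7 + 21925 * fps_X ^ 8"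
proof (rule fps_ext)
  fix i :: nat
  consider "i \<in> {0, 1, 2, 3, 4, 5, 6, 7, 8}" | "i \<ge> 9" by fastforce
  thus "fps_nth (fps_cutoff 9 (Abs_fps quasi4)) i = fps_nth (1 + 8 * fps_X + 48 * fps_X ^ 2 + 200 * fps_X ^ 3 +
      675 * fps_X ^ 4
             + 1904 * fps_X ^ 5 + 4736 * fps_X ^ 6 + 10608 * fps_X ^ 7 + 21925 * fps_X ^ 8) i"
    by cases (auto simp: numeral_fps_const quasi4_def quasi480_def)
qed

lemma quasi4_eq:
  "quasi4 s = (let x = rat_of_nat s in
            if 2 dvd s
            then 1/480 * x^7 + 7/240 * x^6 + 89/480 * x^5 + 11/16 * x^4
                   + 49/30 * x^3 + 38/15 * x^2 + 71/30 * x + 1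
            else 1/480 * x^7 + 7/240 * x^6 + 89/480 * x^5 + 11/16 * x^4
                   + 779/480 * x^3 + 593/240 * x^2 + 1051/480 * x + 13/16)"
  by (simp add: quasi4_def quasi480_def Let_def add_divide_distrib)

section \<open>Evaluation in size 5\<close>

lemma count5_values:
  "count5 0 = 1" "count5 1 = 20" "count5 2 = 449" "count5 3 = 6792" "count5 4 = 67063"
  by code_simp+

lemma count5_5: "count5 5 = 484419"
  by code_simp

lemma count5_6: "count5 6 = 2750715"
  by code_simp
lemma num_magic_squares_5_values:
  assumes "CARD('n::{finite,linorder}) = 5"
  shows "map (num_magic_squares TYPE('n)) [0, 1, 2, 3, 4, 5, 6] =
           [1, 20, 449, 6792, 67063, 484419, 2750715]"
proof -
  have "num_magic_squares TYPE('n) s = nat (count5 (int s))" for s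
    using num_magic_squares_5_eq_count5[OF assms, of s] by simp
  thus ?thesis by (simp add: count5_values count5_5 count5_6)
qed

theorem theorem0p3:
  shows "Abs_fps (\<lambda>s. rat_of_nat (num_magic_squares TYPE(4) s)) =
           (fps_X ^ 8 + 4 * fps_X ^ 7 + 18 * fps_X ^ 6 + 36 * fps_X ^ 5 + 50 * fps_X ^ 4
             + 36 * fps_X ^ 3 + 18 * fps_X ^ 2 + 4 * fps_X + 1)
           / ((1 - fps_X) ^ 4 * (1 - fps_X ^ 2) ^ 4)
       \<and> fps_cutoff 9 (Abs_fps (\<lambda>s. rat_of_nat (num_magic_squares TYPE(4) s))) =
           1 + 8 * fps_X + 48 * fps_X ^ 2 + 200 * fps_X ^ 3 + 675 * fps_X ^ 4
             + 1904 * fps_X ^ 5 + 4736 * fps_X ^ 6 + 10608 * fps_X ^ 7 + 21925 * fps_X ^ 8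
       \<and> (\<forall>s::nat. rat_of_nat (num_magic_squares TYPE(4) s) =
           (let x = rat_of_nat s in
            if 2 dvd s
            then 1/480 * x^7 + 7/240 * x^6 + 89/480 * x^5 + 11/16 * x^4
                   + 49/30 * x^3 + 38/15 * x^2 + 71/30 * x + 1
            else 1/480 * x^7 + 7/240 * x^6 + 89/480 * x^5 + 11/16 * x^4
                   + 779/480 * x^3 + 593/240 * x^2 + 1051/480 * x + 13/16))
       \<and> map (num_magic_squares TYPE(5)) [0, 1, 2, 3, 4, 5, 6] =
           [1, 20, 449, 6792, 67063, 484419, 2750715]
       \<and> (CARD('n::{finite,linorder}) > 2 \<longrightarrow>
           \<not> integral_polytope (stochastic_magic_squares :: (real, 'n) square_matrix set))"
proof -
  have n: "CARD(4) = 4" "CARD(5) = 5" by simp_all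
  note 4 = num_magic_squares_4_quasi4[OF n(1)]
  show ?thesis
    unfolding 4
    using quasi4_fps quasi4_cutoff quasi4_eq num_magic_squares_5_values[OF n(2)] not_integral
    by blast
qed

end
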